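(* Let $1\le p<\infty$ and let $d_{w,p}$ be a Lorentz sequence space which has exactly two mutually non-equivalent symmetric basic sequences (up to equivalence). Then $\overline{J^j}$ is the only immediate successor of $\mathcal K(d_{w,p})$ among closed ideals of $L(d_{w,p})$; that is, $\mathcal K(d_{w,p})\subsetneq \overline{J^j}$, there is no closed ideal strictly between them, and every closed ideal $J$ of $L(d_{w,p})$ with $\mathcal K(d_{w,p})\subsetneq J$ satisfies $\overline{J^j}\subseteq J$.
   Context: Let $1\le p<\infty$ and let $w=(w_n)$ be a real sequence with $w_1=1$, $w_n\downarrow 0$ and $\sum_n w_n=\infty$. The Lorentz sequence space $d_{w,p}$ is the Banach space of all $x=(x_n)\in c_0$ with $\|x\|_{d_{w,p}}=\big(\sum_{n}w_n (x^*_n)^p\big)^{1/p}<\infty$, where $(x^*_n)$ is the non-increasing rearrangement of $(|x_n|)$. Let $(e_n)$, $(f_n)$ be the unit vector bases of $d_{w,p}$, $\ell_p$, and $j\colon\ell_p\to d_{w,p}$ the formal identity, $j(f_n)=e_n$. $J^j$ is the set of $S\in L(d_{w,p})$ of the form $S=AjB$ with $A\in L(d_{w,p})$, $B\in L(d_{w,p},\ell_p)$; $\overline{J^j}$ is its norm closure. $\mathcal K(d_{w,p})$ is the ideal of compact operators. For closed ideals $J_1\subsetneq J_2$, $J_2$ is an immediate successor of $J_1$ if no closed ideal $J$ satisfies $J_1\subsetneq J\subsetneq J_2$. Two basic sequences $(x_n),(y_n)$ are equivalent if $\sum a_nx_n$ converges iff $\sum a_ny_n$ converges. *)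

theory Defs
  imports "HOL-Analysis.Analysis"
begin

type_synonym rseq = "nat \<Rightarrow> real"

text \<open>Non-increasing rearrangement of (|x_n|), indexed from 0:
  x*_n = inf over index sets F with |F| = n of sup of |x_k| for k outside F.\<close>
definition rearr :: "rseq \<Rightarrow> nat \<Rightarrow> real" where
  "rearr x n = (INF F\<in>{F. finite F \<and> card F = n}. (SUP k\<in>- F. \<bar>x k\<bar>))"

definition lorentz_space :: "rseq \<Rightarrow> real \<Rightarrow> rseq set" where
  "lorentz_space w p = {x. x \<longlonglongrightarrow> 0 \<and> summable (\<lambda>n. w n * rearr x n powr p)}"

definition lorentz_norm :: "rseq \<Rightarrow> real \<Rightarrow> rseq \<Rightarrow> real" where
  "lorentz_norm w p x = (\<Sum>n. w n * rearr x n powr p) powr (1 / p)"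

definition lp_space :: "real \<Rightarrow> rseq set" where
  "lp_space p = {x. summable (\<lambda>n. \<bar>x n\<bar> powr p)}"

definition lp_norm :: "real \<Rightarrow> rseq \<Rightarrow> real" where
  "lp_norm p x = (\<Sum>n. \<bar>x n\<bar> powr p) powr (1 / p)"

text \<open>Bounded linear operators X -> Y between sequence spaces; an operator is
  represented by a function normalised to be 0 outside its domain X.\<close>
definition bdd_op :: "rseq set \<Rightarrow> (rseq \<Rightarrow> real) \<Rightarrow> rseq set \<Rightarrow> (rseq \<Rightarrow> real)
    \<Rightarrow> (rseq \<Rightarrow> rseq) \<Rightarrow> bool" where
  "bdd_op X NX Y NY T \<longleftrightarrow>
     (\<forall>x\<in>X. T x \<in> Y) \<and>
     (\<forall>x\<in>X. \<forall>y\<in>X. T (\<lambda>n. x n + y n) = (\<lambda>n. T x n + T y n)) \<and>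
     (\<forall>x\<in>X. \<forall>c. T (\<lambda>n. c * x n) = (\<lambda>n. c * T x n)) \<and>
     (\<exists>C. \<forall>x\<in>X. NY (T x) \<le> C * NX x) \<and>
     (\<forall>x. x \<notin> X \<longrightarrow> T x = (\<lambda>n. 0))"

definition opnorm :: "rseq set \<Rightarrow> (rseq \<Rightarrow> real) \<Rightarrow> (rseq \<Rightarrow> real) \<Rightarrow> (rseq \<Rightarrow> rseq) \<Rightarrow> real" where
  "opnorm X NX NY T = Sup ((\<lambda>x. NY (T x)) ` {x\<in>X. NX x \<le> 1})"

definition Lop :: "rseq \<Rightarrow> real \<Rightarrow> (rseq \<Rightarrow> rseq) set" where
  "Lop w p = {T. bdd_op (lorentz_space w p) (lorentz_norm w p) (lorentz_space w p) (lorentz_norm w p) T}"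

definition Lop_lp :: "rseq \<Rightarrow> real \<Rightarrow> (rseq \<Rightarrow> rseq) set" where
  "Lop_lp w p = {T. bdd_op (lorentz_space w p) (lorentz_norm w p) (lp_space p) (lp_norm p) T}"

definition dopnorm :: "rseq \<Rightarrow> real \<Rightarrow> (rseq \<Rightarrow> rseq) \<Rightarrow> real" where
  "dopnorm w p T = opnorm (lorentz_space w p) (lorentz_norm w p) (lorentz_norm w p) T"

definition op_diff :: "(rseq \<Rightarrow> rseq) \<Rightarrow> (rseq \<Rightarrow> rseq) \<Rightarrow> (rseq \<Rightarrow> rseq)" where
  "op_diff T S = (\<lambda>x n. T x n - S x n)"

definition formal_id :: "real \<Rightarrow> rseq \<Rightarrow> rseq" where
  "formal_id p x = (if x \<in> lp_space p then x else (\<lambda>n. 0))"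

definition closed_ideal :: "rseq \<Rightarrow> real \<Rightarrow> (rseq \<Rightarrow> rseq) set \<Rightarrow> bool" where
  "closed_ideal w p J \<longleftrightarrow>
     J \<subseteq> Lop w p \<and>
     (\<lambda>x n. 0) \<in> J \<and>
     (\<forall>S\<in>J. \<forall>T\<in>J. (\<lambda>x n. S x n + T x n) \<in> J) \<and>
     (\<forall>c. \<forall>S\<in>J. (\<lambda>x n. c * S x n) \<in> J) \<and>
     (\<forall>A\<in>Lop w p. \<forall>S\<in>J. \<forall>B\<in>Lop w p. A \<circ> S \<circ> B \<in> J) \<and>
     (\<forall>T\<in>Lop w p. (\<forall>e>0. \<exists>S\<in>J. dopnorm w p (op_diff T S) < e) \<longrightarrow> T \<in> J)"

definition compact_ops :: "rseq \<Rightarrow> real \<Rightarrow> (rseq \<Rightarrow> rseq) set" where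
  "compact_ops w p = {T \<in> Lop w p.
     \<forall>xs. (\<forall>k. xs k \<in> lorentz_space w p) \<and> (\<exists>M. \<forall>k. lorentz_norm w p (xs k) \<le> M) \<longrightarrow>
       (\<exists>r::nat\<Rightarrow>nat. strict_mono r \<and> (\<exists>y\<in>lorentz_space w p.
          (\<lambda>k. lorentz_norm w p (\<lambda>n. T (xs (r k)) n - y n)) \<longlonglongrightarrow> 0))}"

definition Jj :: "rseq \<Rightarrow> real \<Rightarrow> (rseq \<Rightarrow> rseq) set" where
  "Jj w p = {T. \<exists>A\<in>Lop w p. \<exists>B\<in>Lop_lp w p. T = A \<circ> formal_id p \<circ> B}"

definition Jj_closure :: "rseq \<Rightarrow> real \<Rightarrow> (rseq \<Rightarrow> rseq) set" where
  "Jj_closure w p = {T \<in> Lop w p. \<forall>e>0. \<exists>S\<in>Jj w p. dopnorm w p (op_diff T S) < e}"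

definition series_conv :: "rseq \<Rightarrow> real \<Rightarrow> (nat \<Rightarrow> real) \<Rightarrow> (nat \<Rightarrow> rseq) \<Rightarrow> bool" where
  "series_conv w p a x \<longleftrightarrow> (\<exists>z\<in>lorentz_space w p.
     (\<lambda>m. lorentz_norm w p (\<lambda>k. (\<Sum>i<m. a i * x i k) - z k)) \<longlonglongrightarrow> 0)"

definition closed_span :: "rseq \<Rightarrow> real \<Rightarrow> (nat \<Rightarrow> rseq) \<Rightarrow> rseq set" where
  "closed_span w p x = {y \<in> lorentz_space w p. \<forall>e>0. \<exists>m a.
     lorentz_norm w p (\<lambda>k. y k - (\<Sum>i<m. a i * x i k)) < e}"

definition basic_seq :: "rseq \<Rightarrow> real \<Rightarrow> (nat \<Rightarrow> rseq) \<Rightarrow> bool" where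
  "basic_seq w p x \<longleftrightarrow> (\<forall>i. x i \<in> lorentz_space w p) \<and>
     (\<forall>y\<in>closed_span w p x. \<exists>!a.
        (\<lambda>m. lorentz_norm w p (\<lambda>k. (\<Sum>i<m. a i * x i k) - y k)) \<longlonglongrightarrow> 0)"

definition seq_equiv :: "rseq \<Rightarrow> real \<Rightarrow> (nat \<Rightarrow> rseq) \<Rightarrow> (nat \<Rightarrow> rseq) \<Rightarrow> bool" where
  "seq_equiv w p x y \<longleftrightarrow> (\<forall>a. series_conv w p a x \<longleftrightarrow> series_conv w p a y)"

definition symmetric_basic :: "rseq \<Rightarrow> real \<Rightarrow> (nat \<Rightarrow> rseq) \<Rightarrow> bool" where
  "symmetric_basic w p x \<longleftrightarrow> basic_seq w p x \<and>
     (\<forall>\<pi>. bij \<pi> \<longrightarrow> seq_equiv w p x (x \<circ> \<pi>))"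

end

theory Submission
  imports Defs "HOL-Complex_Analysis.Great_Picard"
begin

text \<open>
  For disjoint vectors the Lorentz norm satisfies an upper p-estimate with constant one, so the unit vectors of
  lp can be mapped to any bounded sequence of disjoint vectors. A noncompact operator \<open>T\<close> sends
  some bounded sequence of disjoint vectors to a coordinatewise null sequence that is bounded below in norm.
  Passing to a subsequence, the images either keep coordinates bounded away from zero, in which case a coordinate selection
  maps them almost to the unit vectors of the Lorentz space, or they tend to zero uniformly, in which case suitable weighted
  averages map them almost to the unit vectors of lp. Either way \<open>C \<circ> T \<circ> D\<close> is
  as close as desired to the formal identity, so every closed ideal containing a noncompact operator contains
  \<open>J\<^sup>j\<close>. The second case applied to flat vectors also yields a noncompact
  member of \<open>J\<^sup>j\<close>; compact operators lie in its closure by truncation of their values.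
\<close>

subsection \<open>The Lorentz norm as a supremum of weighted lp-norms\<close>

text \<open>The rearrangement is not subadditive and behaves badly under sums and limits. By the
  rearrangement inequality, the p-th power of the norm is also the supremum of the finite sums of
  \<open>w (\<sigma> i) * \<bar>x i\<bar> powr p\<close> over injective \<open>\<sigma>\<close>. In
  this form each estimate is made inside one finite sum, and norming weights of different blocks can
  be glued into one injection. Two further points shape the argument. An operator need not respect
  coordinatewise limits, so subtracting the limit of a bounded sequence need not make the images
  null; differences of far members make both sequences null, in the same way for all p \<ge> 1. And
  errors are measured against the lp-norm of the coefficients: each coefficient is at most this
  norm, so errors on the unit vectors with sum at most \<open>e\<close> give an operator error of at
  most \<open>e\<close>. Partial sums are passed to the limit coordinatewise, by lower
  semicontinuity of the norm.\<close>

lemma convex_on_powr_nonneg: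
  fixes p :: real
  assumes "1 \<le> p"
  shows "convex_on {0..} (\<lambda>x. x powr p)"
proof (rule convex_onI)
  fix t x y :: real
  assume t: "0 < t" "t < 1" and x: "x \<in> {0..}" and y: "y \<in> {0..}"
  have le: "s powr p \<le> s" if "0 < s" "s < 1" for s
    using powr_le_one_le[of s p] that assms by simp
  consider "x = 0" | "y = 0" | "x > 0" "y > 0" using x y by force
  then show "((1 - t) *\<^sub>R x + t *\<^sub>R y) powr p \<le> (1 - t) * x powr p + t * y powr p"
  proof cases
    case 1
    then show ?thesis using t y assms le[of t] by (auto simp: powr_mult intro!: mult_right_mono)
  next
    case 2
    then show ?thesis using t x assms le[of "1 - t"] by (auto simp: powr_mult intro!: mult_right_mono)
  next
    case 3
    then show ?thesis
      using convex_onD[OF powr_convex[OF assms], of t x y] t by simp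
  qed
qed simp

text \<open>Jensen's inequality for the p-th power with the weights \<open>c i\<close> divided by
  their sum. It controls the averaging functionals by which flat vectors are sent to lp.\<close>

lemma weighted_power_mean:
  fixes p :: real and c a :: "'a \<Rightarrow> real"
  assumes "1 \<le> p" "finite I" "\<And>i. i \<in> I \<Longrightarrow> 0 \<le> c i" "0 < sum c I"
  shows "\<bar>\<Sum>i\<in>I. c i * a i\<bar> powr p \<le> sum c I powr (p - 1) * (\<Sum>i\<in>I. c i * \<bar>a i\<bar> powr p)"
proof -
  let ?S = "sum c I"
  have "I \<noteq> {}" using assms(4) by auto
  have "(\<Sum>i\<in>I. (c i / ?S) *\<^sub>R \<bar>a i\<bar>) powr p \<le> (\<Sum>i\<in>I. (c i / ?S) * \<bar>a i\<bar> powr p)"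
    by (rule convex_on_sum[OF assms(2) \<open>I \<noteq> {}\<close> convex_on_powr_nonneg[OF assms(1)]])
      (use assms in \<open>auto simp: sum_divide_distrib[symmetric]\<close>)
  moreover have "(\<Sum>i\<in>I. (c i / ?S) *\<^sub>R \<bar>a i\<bar>) = (\<Sum>i\<in>I. c i * \<bar>a i\<bar>) / ?S"
    by (simp add: sum_divide_distrib)
  moreover have "(\<Sum>i\<in>I. (c i / ?S) * \<bar>a i\<bar> powr p) = (\<Sum>i\<in>I. c i * \<bar>a i\<bar> powr p) / ?S"
    by (simp add: sum_divide_distrib)
  ultimately have *: "((\<Sum>i\<in>I. c i * \<bar>a i\<bar>) / ?S) powr p \<le> (\<Sum>i\<in>I. c i * \<bar>a i\<bar> powr p) / ?S"
    by simp
  have nn: "0 \<le> (\<Sum>i\<in>I. c i * \<bar>a i\<bar>)" using assms(3) by (auto intro!: sum_nonneg)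
  have "\<bar>\<Sum>i\<in>I. c i * a i\<bar> powr p \<le> (\<Sum>i\<in>I. c i * \<bar>a i\<bar>) powr p"
  proof (rule powr_mono2)
    show "\<bar>\<Sum>i\<in>I. c i * a i\<bar> \<le> (\<Sum>i\<in>I. c i * \<bar>a i\<bar>)"
      by (rule order_trans[OF sum_abs]) (use assms(3) in \<open>auto intro!: sum_mono simp: abs_mult\<close>)
  qed (use assms in auto)
  also have "\<dots> = ?S powr p * ((\<Sum>i\<in>I. c i * \<bar>a i\<bar>) / ?S) powr p"
    using nn assms(4) by (simp add: powr_divide)
  also have "\<dots> \<le> ?S powr p * ((\<Sum>i\<in>I. c i * \<bar>a i\<bar> powr p) / ?S)"
    using * by (intro mult_left_mono) auto
  also have "\<dots> = ?S powr (p - 1) * (\<Sum>i\<in>I. c i * \<bar>a i\<bar> powr p)"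
    using assms(4) by (simp add: powr_diff)
  finally show ?thesis .
qed

section \<open>The non-increasing rearrangement\<close>

lemma rearr_le:
  assumes "finite F" "card F = n" "\<And>k. k \<notin> F \<Longrightarrow> \<bar>x k\<bar> \<le> c"
  shows "rearr x n \<le> c"
proof -
  obtain B where B: "\<bar>x k\<bar> \<le> B" for k
  proof
    fix k show "\<bar>x k\<bar> \<le> max c (\<Sum>k\<in>F. \<bar>x k\<bar>)"
      using assms member_le_sum[of k F "\<lambda>k. \<bar>x k\<bar>"] by (cases "k \<in> F") (auto simp: le_max_iff_disj)
  qed
  have ne: "- G \<noteq> {}" if "finite G" for G :: "nat set"
    using that by (metis Compl_eq_Diff_UNIV Diff_eq_empty_iff infinite_UNIV_nat rev_finite_subset)
  have bdd: "bdd_below ((\<lambda>F. SUP k\<in>- F. \<bar>x k\<bar>) ` {F. finite F \<and> card F = n})"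
  proof (rule bdd_belowI2)
    fix G :: "nat set" assume "G \<in> {F. finite F \<and> card F = n}"
    then obtain k where "k \<in> - G" using ne by blast
    have "0 \<le> \<bar>x k\<bar>" by simp
    also have "\<bar>x k\<bar> \<le> (SUP k\<in>- G. \<bar>x k\<bar>)"
      by (rule cSUP_upper[OF \<open>k \<in> - G\<close>]) (rule bdd_aboveI2[of _ _ B], rule B)
    finally show "0 \<le> (SUP k\<in>- G. \<bar>x k\<bar>)" .
  qed
  have "rearr x n \<le> (SUP k\<in>- F. \<bar>x k\<bar>)"
    unfolding rearr_def by (rule cINF_lower[OF bdd]) (use assms in auto)
  also have "\<dots> \<le> c"
    by (rule cSUP_least[OF ne[OF assms(1)]]) (use assms(3) in auto)
  finally show ?thesis .
qed

lemma le_rearr: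
  assumes "\<And>k. \<bar>x k\<bar> \<le> B" and "finite G" "n < card G" "\<And>k. k \<in> G \<Longrightarrow> c \<le> \<bar>x k\<bar>"
  shows "c \<le> rearr x n"
  unfolding rearr_def
proof (rule cINF_greatest)
  have "{..<n} \<in> {F. finite F \<and> card F = n}" by simp
  then show "{F::nat set. finite F \<and> card F = n} \<noteq> {}" by blast
  fix F :: "nat set" assume F: "F \<in> {F. finite F \<and> card F = n}"
  then have "\<not> G \<subseteq> F" using assms(3) card_mono[of F G] by auto
  then obtain k where k: "k \<in> G" "k \<notin> F" by blast
  have "c \<le> \<bar>x k\<bar>" using k assms(4) by blast
  also have "\<bar>x k\<bar> \<le> (SUP k\<in>- F. \<bar>x k\<bar>)"
    by (rule cSUP_upper) (use k in simp, rule bdd_aboveI2[of _ _ B], rule assms(1))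
  finally show "c \<le> (SUP k\<in>- F. \<bar>x k\<bar>)" .
qed

lemma rearr_nonneg:
  assumes "\<And>k. \<bar>x k\<bar> \<le> B"
  shows "0 \<le> rearr x n"
  by (rule le_rearr[OF assms, of "{..n}"]) auto

lemma rearr_mono:
  assumes "\<And>k. \<bar>x k\<bar> \<le> \<bar>y k\<bar>" and "\<And>k. \<bar>y k\<bar> \<le> B"
  shows "rearr x n \<le> rearr y n"
proof -
  have "{..<n} \<in> {F. finite F \<and> card F = n}" by simp
  then have ne: "{F::nat set. finite F \<and> card F = n} \<noteq> {}" by blast
  have "rearr x n \<le> (SUP k\<in>- F. \<bar>y k\<bar>)" if F: "F \<in> {F. finite F \<and> card F = n}" for F :: "nat set"
  proof (rule rearr_le[of F])
    fix k assume "k \<notin> F"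
    have "\<bar>x k\<bar> \<le> \<bar>y k\<bar>" by (rule assms)
    also have "\<dots> \<le> (SUP k\<in>- F. \<bar>y k\<bar>)"
      by (rule cSUP_upper) (use \<open>k \<notin> F\<close> in simp, rule bdd_aboveI2[of _ _ B], rule assms(2))
    finally show "\<bar>x k\<bar> \<le> (SUP k\<in>- F. \<bar>y k\<bar>)" .
  qed (use F in auto)
  then show ?thesis
    unfolding rearr_def[of y] by (intro cINF_greatest[OF ne])
qed

lemma null_seq_bounded:
  fixes x :: rseq
  assumes "x \<longlonglongrightarrow> 0"
  obtains B where "\<And>k. \<bar>x k\<bar> \<le> B"
  using convergent_imp_Bseq[of x] assms by (auto simp: convergent_def Bseq_def)

lemma null_seq_max_outside:
  fixes x :: rseq
  assumes "x \<longlonglongrightarrow> 0" "finite F"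
  shows "\<exists>k. k \<notin> F \<and> (\<forall>j. j \<notin> F \<longrightarrow> \<bar>x j\<bar> \<le> \<bar>x k\<bar>)"
proof (cases "\<exists>k. k \<notin> F \<and> x k \<noteq> 0")
  case False
  then show ?thesis using ex_new_if_finite[OF infinite_UNIV_nat assms(2)] by force
next
  case True
  then obtain k0 where k0: "k0 \<notin> F" "x k0 \<noteq> 0" by blast
  let ?G = "{k. \<bar>x k0\<bar> \<le> \<bar>x k\<bar>} - F"
  from assms(1) k0 obtain N where "\<forall>k\<ge>N. \<bar>x k\<bar> < \<bar>x k0\<bar>"
    using LIMSEQ_D[of x 0 "\<bar>x k0\<bar>"] by auto
  then have "k < N" if "k \<in> ?G" for k using that by (metis DiffD1 linorder_not_le mem_Collect_eq)
  then have "?G \<subseteq> {..<N}" by blast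
  then have fin: "finite ?G" by (rule finite_subset) simp
  have "k0 \<in> ?G" using k0 by simp
  then have "Max ((\<lambda>k. \<bar>x k\<bar>) ` ?G) \<in> (\<lambda>k. \<bar>x k\<bar>) ` ?G"
    using fin by (intro Max_in) auto
  then have "\<exists>k\<in>?G. \<forall>j\<in>?G. \<bar>x j\<bar> \<le> \<bar>x k\<bar>"
    using fin Max_ge[of "(\<lambda>k. \<bar>x k\<bar>) ` ?G"] by (elim imageE) (metis finite_imageI imageI)
  then obtain k where k: "k \<in> ?G" "\<forall>j\<in>?G. \<bar>x j\<bar> \<le> \<bar>x k\<bar>" by blast
  have "\<bar>x j\<bar> \<le> \<bar>x k\<bar>" if "j \<notin> F" for j
    using k that by (cases "\<bar>x k0\<bar> \<le> \<bar>x j\<bar>") auto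
  then show ?thesis using k by blast
qed

text \<open>Greedy choice of a largest remaining entry. The induction stops at a finite
  \<open>N\<close>, which suits norm estimates by partial sums and avoids a decreasing enumeration
  of all indices.\<close>

lemma rearr_le_enumeration:
  fixes x :: rseq
  assumes "x \<longlonglongrightarrow> 0"
  shows "\<exists>g::nat \<Rightarrow> nat. inj_on g {..<N} \<and> (\<forall>n<N. rearr x n \<le> \<bar>x (g n)\<bar>)"
proof (induction N)
  case 0
  then show ?case by simp
next
  case (Suc N)
  then obtain g where g: "inj_on g {..<N}" "\<And>n. n < N \<Longrightarrow> rearr x n \<le> \<bar>x (g n)\<bar>" by blast
  obtain k where k: "k \<notin> g ` {..<N}" "\<And>j. j \<notin> g ` {..<N} \<Longrightarrow> \<bar>x j\<bar> \<le> \<bar>x k\<bar>"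
    using null_seq_max_outside[OF assms, of "g ` {..<N}"] by blast
  have "rearr x N \<le> \<bar>x k\<bar>"
    by (rule rearr_le[of "g ` {..<N}"]) (use k g in \<open>auto simp: card_image\<close>)
  moreover have "inj_on (g(N := k)) {..<Suc N}"
    using g(1) k(1) by (auto simp: lessThan_Suc inj_on_def)
  ultimately have "inj_on (g(N := k)) {..<Suc N} \<and> (\<forall>n<Suc N. rearr x n \<le> \<bar>x ((g(N := k)) n)\<bar>)"
    using g(2) by (metis fun_upd_apply less_SucE)
  then show ?case by blast
qed

section \<open>The Lorentz norm by finite weighted sums\<close>

locale lorentz_weight =
  fixes w :: rseq and p :: real
  assumes p: "1 \<le> p"
    and w1: "w 0 = 1" and wdec: "decseq w" and w0: "w \<longlonglongrightarrow> 0" and wdiv: "\<not> summable w"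
begin

abbreviation "d \<equiv> lorentz_space w p"
abbreviation "nm \<equiv> lorentz_norm w p"

lemma p_pos: "0 < p" using p by simp

lemma w_nonneg: "0 \<le> w n"
  using decseq_ge[OF wdec w0] .

lemma w_le_1: "w n \<le> 1"
  using wdec w1 by (metis decseqD le0)

lemma w_sum_unbounded: "\<exists>N. C < (\<Sum>n<N. w n)"
proof (rule ccontr)
  assume "\<not> ?thesis"
  then have "\<And>N. (\<Sum>n<N. w n) \<le> C" by (simp add: not_less)
  then have "summable w" by (intro summableI_nonneg_bounded[of w C] w_nonneg)
  with wdiv show False by simp
qed

text \<open>Encodes that \<open>x\<close> is in the space with p-th power of its norm at most
  \<open>C\<close>. The map \<open>\<sigma>\<close> assigns distinct weights to finitely many
  coordinates in any order; the decreasing rearrangement is the optimal assignment.\<close>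

definition wbound :: "rseq \<Rightarrow> real \<Rightarrow> bool" where
  "wbound x C \<longleftrightarrow> (\<forall>I \<sigma>. finite I \<and> inj_on \<sigma> I \<longrightarrow> (\<Sum>i\<in>I. w (\<sigma> i) * \<bar>x i\<bar> powr p) \<le> C)"

lemma wboundI:
  "(\<And>I \<sigma>. finite I \<Longrightarrow> inj_on \<sigma> I \<Longrightarrow> (\<Sum>i\<in>I. w (\<sigma> i) * \<bar>x i\<bar> powr p) \<le> C) \<Longrightarrow> wbound x C"
  by (auto simp: wbound_def)

lemma wboundD:
  "wbound x C \<Longrightarrow> finite I \<Longrightarrow> inj_on \<sigma> I \<Longrightarrow> (\<Sum>i\<in>I. w (\<sigma> i) * \<bar>x i\<bar> powr p) \<le> C"
  by (auto simp: wbound_def)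

text \<open>Moving the largest weight index onto the smallest entry
  frees that entry for the induction.\<close>

lemma weighted_sum_le_rearr:
  assumes B: "\<And>k. \<bar>x k\<bar> \<le> B"
  shows "finite I \<Longrightarrow> inj_on \<sigma> I \<Longrightarrow> card I = N \<Longrightarrow>
    (\<Sum>i\<in>I. w (\<sigma> i) * \<bar>x i\<bar> powr p) \<le> (\<Sum>n<N. w n * rearr x n powr p)"
proof (induction N arbitrary: I \<sigma>)
  case 0
  then show ?case by simp
next
  case (Suc N)
  then have "I \<noteq> {}" by auto
  obtain i where i: "i \<in> I" "\<And>k. k \<in> I \<Longrightarrow> \<bar>x i\<bar> \<le> \<bar>x k\<bar>"
    using Suc.prems(1) \<open>I \<noteq> {}\<close> arg_min_if_finite(1)[of I "\<lambda>k. \<bar>x k\<bar>"] arg_min_least[of I _ "\<lambda>k. \<bar>x k\<bar>"]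
    by metis
  have "Max (\<sigma> ` I) \<in> \<sigma> ` I" using Suc.prems(1) \<open>I \<noteq> {}\<close> by (intro Max_in) auto
  then obtain j where j: "j \<in> I" "\<sigma> j = Max (\<sigma> ` I)" by auto
  have jmax: "\<sigma> k \<le> \<sigma> j" if "k \<in> I" for k using that j Suc.prems(1) by simp
  \<comment> \<open>The N + 1 distinct weight indices are all at most \<open>\<sigma> j\<close>, so
    the weight given to the removed entry is at most \<open>w N\<close>.\<close>
  have "N \<le> \<sigma> j"
  proof -
    have "\<sigma> ` I \<subseteq> {..\<sigma> j}" using jmax by auto
    then have "card (\<sigma> ` I) \<le> card {..\<sigma> j}" by (intro card_mono) auto
    then show ?thesis using Suc.prems by (simp add: card_image)
  qed
  let ?s = "\<sigma>(j := \<sigma> i)"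
  have "inj_on ?s (I - {i})"
    using Suc.prems(2) i(1) j(1) by (auto simp: inj_on_def)
  then have IH: "(\<Sum>k\<in>I - {i}. w (?s k) * \<bar>x k\<bar> powr p) \<le> (\<Sum>n<N. w n * rearr x n powr p)"
    by (rule Suc.IH[rotated]) (use Suc.prems i(1) in simp_all)
  have xi: "\<bar>x i\<bar> \<le> rearr x N"
    by (rule le_rearr[OF B Suc.prems(1)]) (use Suc.prems i in auto)
  have "(\<Sum>k\<in>I. w (\<sigma> k) * \<bar>x k\<bar> powr p) \<le> w (\<sigma> j) * \<bar>x i\<bar> powr p + (\<Sum>k\<in>I - {i}. w (?s k) * \<bar>x k\<bar> powr p)"
  proof (cases "j = i")
    case True
    then have "(\<Sum>k\<in>I - {i}. w (?s k) * \<bar>x k\<bar> powr p) = (\<Sum>k\<in>I - {i}. w (\<sigma> k) * \<bar>x k\<bar> powr p)"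
      by (intro sum.cong) auto
    then show ?thesis using sum.remove[OF Suc.prems(1) i(1), of "\<lambda>k. w (\<sigma> k) * \<bar>x k\<bar> powr p"] True by simp
  next
    case False
    let ?R = "\<Sum>k\<in>I - {i} - {j}. w (\<sigma> k) * \<bar>x k\<bar> powr p"
    have j': "j \<in> I - {i}" using j(1) False by simp
    have 1: "(\<Sum>k\<in>I. w (\<sigma> k) * \<bar>x k\<bar> powr p) = w (\<sigma> i) * \<bar>x i\<bar> powr p + (w (\<sigma> j) * \<bar>x j\<bar> powr p + ?R)"
      using sum.remove[OF Suc.prems(1) i(1), of "\<lambda>k. w (\<sigma> k) * \<bar>x k\<bar> powr p"]
        sum.remove[OF _ j', of "\<lambda>k. w (\<sigma> k) * \<bar>x k\<bar> powr p"] Suc.prems(1) by simp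
    have 2: "(\<Sum>k\<in>I - {i}. w (?s k) * \<bar>x k\<bar> powr p) = w (\<sigma> i) * \<bar>x j\<bar> powr p + ?R"
      using sum.remove[OF _ j', of "\<lambda>k. w (?s k) * \<bar>x k\<bar> powr p"] Suc.prems(1) by simp
    \<comment> \<open>The two-term rearrangement inequality: exchanging the weights of
      \<open>i\<close> and \<open>j\<close> can only increase the sum.\<close>
    have "0 \<le> (w (\<sigma> i) - w (\<sigma> j)) * (\<bar>x j\<bar> powr p - \<bar>x i\<bar> powr p)"
      using jmax[OF i(1)] wdec i(2)[OF j(1)] p
      by (intro mult_nonneg_nonneg) (auto simp: decseq_def intro!: powr_mono2)
    then show ?thesis unfolding 1 2 by (simp add: algebra_simps)
  qed
  also have "w (\<sigma> j) * \<bar>x i\<bar> powr p \<le> w N * rearr x N powr p"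
    using wdec \<open>N \<le> \<sigma> j\<close> xi w_nonneg p by (intro mult_mono powr_mono2) (auto simp: decseq_def)
  finally show ?case using IH by simp
qed

lemma rearr_sum_le:
  assumes "x \<longlonglongrightarrow> 0" "wbound x C"
  shows "(\<Sum>n<N. w n * rearr x n powr p) \<le> C"
proof -
  obtain g where g: "inj_on g {..<N}" "\<And>n. n < N \<Longrightarrow> rearr x n \<le> \<bar>x (g n)\<bar>"
    using rearr_le_enumeration[OF assms(1)] by blast
  obtain B where B: "\<And>k. \<bar>x k\<bar> \<le> B" using null_seq_bounded[OF assms(1)] by blast
  let ?s = "the_inv_into {..<N} g"
  have "(\<Sum>n<N. w n * rearr x n powr p) \<le> (\<Sum>n<N. w n * \<bar>x (g n)\<bar> powr p)"
    using g(2) w_nonneg p rearr_nonneg[OF B]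
    by (intro sum_mono mult_left_mono powr_mono2) auto
  also have "\<dots> = (\<Sum>i\<in>g ` {..<N}. w (?s i) * \<bar>x i\<bar> powr p)"
    using g(1) by (subst sum.reindex) (auto simp: the_inv_into_f_f)
  also have "\<dots> \<le> C"
    by (rule wboundD[OF assms(2)]) (use g(1) in \<open>auto intro: inj_on_the_inv_into\<close>)
  finally show ?thesis .
qed

text \<open>Divergence of the weights acts here: if infinitely many entries had modulus at least
  \<open>e\<close>, any N of them could be assigned the first N weights, and the resulting sums
  would be unbounded.\<close>

lemma wbound_imp_null:
  assumes "wbound x C"
  shows "x \<longlonglongrightarrow> 0"
proof (rule ccontr)
  assume "\<not> x \<longlonglongrightarrow> 0"
  then obtain e where e: "e > 0" "\<And>N. \<exists>n\<ge>N. e \<le> \<bar>x n\<bar>"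
    by (auto simp: LIMSEQ_iff not_less)
  then have inf: "infinite {n. e \<le> \<bar>x n\<bar>}"
    by (auto simp: infinite_nat_iff_unbounded_le)
  obtain N where N: "C / e powr p < (\<Sum>n<N. w n)" using w_sum_unbounded by blast
  obtain I where I: "I \<subseteq> {n. e \<le> \<bar>x n\<bar>}" "finite I" "card I = N"
    using infinite_arbitrarily_large[OF inf] by blast
  obtain \<sigma> where s: "bij_betw \<sigma> I {..<N}"
    using I finite_same_card_bij[of I "{..<N}"] by auto
  have "(\<Sum>n<N. w n) * e powr p = (\<Sum>i\<in>I. w (\<sigma> i) * e powr p)"
    unfolding sum_distrib_right[symmetric] using sum.reindex_bij_betw[OF s, of w] by simp
  also have "\<dots> \<le> (\<Sum>i\<in>I. w (\<sigma> i) * \<bar>x i\<bar> powr p)"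
    using I(1) e(1) p w_nonneg by (intro sum_mono mult_left_mono powr_mono2) auto
  also have "\<dots> \<le> C" using s by (intro wboundD[OF assms] I) (auto simp: bij_betw_def)
  finally show False using N e(1) by (simp add: divide_less_eq)
qed

lemma lorentz_memI:
  assumes "wbound x C"
  shows "x \<in> d"
proof -
  have null: "x \<longlonglongrightarrow> 0" by (rule wbound_imp_null[OF assms])
  then obtain B where B: "\<And>k. \<bar>x k\<bar> \<le> B" using null_seq_bounded by blast
  have "summable (\<lambda>n. w n * rearr x n powr p)"
    by (rule summableI_nonneg_bounded[of _ C]) (use w_nonneg rearr_sum_le[OF null assms] in auto)
  then show ?thesis using null by (simp add: lorentz_space_def)
qed

lemma nm_nonneg: "0 \<le> nm x"
  by (simp add: lorentz_norm_def)

lemma nm_powr: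
  assumes "x \<in> d"
  shows "nm x powr p = (\<Sum>n. w n * rearr x n powr p)"
proof -
  have "0 \<le> (\<Sum>n. w n * rearr x n powr p)"
    using assms w_nonneg by (intro suminf_nonneg) (auto simp: lorentz_space_def)
  then show ?thesis using p by (simp add: lorentz_norm_def powr_powr)
qed

lemma wbound_nm:
  assumes "x \<in> d"
  shows "wbound x (nm x powr p)"
proof (rule wboundI)
  fix I :: "nat set" and \<sigma> :: "nat \<Rightarrow> nat" assume I: "finite I" "inj_on \<sigma> I"
  have null: "x \<longlonglongrightarrow> 0" and sm: "summable (\<lambda>n. w n * rearr x n powr p)"
    using assms by (auto simp: lorentz_space_def)
  then obtain B where B: "\<And>k. \<bar>x k\<bar> \<le> B" using null_seq_bounded by blast
  have "(\<Sum>i\<in>I. w (\<sigma> i) * \<bar>x i\<bar> powr p) \<le> (\<Sum>n<card I. w n * rearr x n powr p)"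
    by (rule weighted_sum_le_rearr[OF B I]) simp
  also have "\<dots> \<le> nm x powr p"
    unfolding nm_powr[OF assms] by (rule sum_le_suminf[OF sm]) (use w_nonneg in auto)
  finally show "(\<Sum>i\<in>I. w (\<sigma> i) * \<bar>x i\<bar> powr p) \<le> nm x powr p" .
qed

lemma nm_powr_le:
  assumes "wbound x C"
  shows "nm x powr p \<le> C"
proof -
  have x: "x \<in> d" by (rule lorentz_memI[OF assms])
  then show ?thesis unfolding nm_powr[OF x]
    by (intro suminf_le_const rearr_sum_le[OF _ assms]) (auto simp: lorentz_space_def)
qed

lemma powr_p_le_iff: "0 \<le> a \<Longrightarrow> 0 \<le> b \<Longrightarrow> a powr p \<le> b powr p \<longleftrightarrow> a \<le> b"
  using p powr_mono2[of p a b] powr_less_mono2[of p b a] by force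

lemma nm_leI: "wbound x (C powr p) \<Longrightarrow> 0 \<le> C \<Longrightarrow> nm x \<le> C"
  using nm_powr_le[of x "C powr p"] powr_p_le_iff[OF nm_nonneg] by blast

lemma wbound_mono: "wbound x C \<Longrightarrow> C \<le> C' \<Longrightarrow> wbound x C'"
  unfolding wbound_def by force

lemma wbound_le:
  assumes "x \<in> d" "nm x \<le> C"
  shows "wbound x (C powr p)"
  using assms p nm_nonneg by (intro wbound_mono[OF wbound_nm] powr_mono2) auto

lemma wbound_abs_mono:
  assumes "wbound y C" "\<And>k. \<bar>x k\<bar> \<le> \<bar>y k\<bar>"
  shows "wbound x C"
proof (rule wboundI)
  fix I :: "nat set" and \<sigma> :: "nat \<Rightarrow> nat" assume I: "finite I" "inj_on \<sigma> I"
  have "(\<Sum>i\<in>I. w (\<sigma> i) * \<bar>x i\<bar> powr p) \<le> (\<Sum>i\<in>I. w (\<sigma> i) * \<bar>y i\<bar> powr p)"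
    using assms(2) w_nonneg p by (intro sum_mono mult_left_mono powr_mono2) auto
  also have "\<dots> \<le> C" using wboundD[OF assms(1) I] .
  finally show "(\<Sum>i\<in>I. w (\<sigma> i) * \<bar>x i\<bar> powr p) \<le> C" .
qed

lemma d_abs_mono: "y \<in> d \<Longrightarrow> (\<And>k. \<bar>x k\<bar> \<le> \<bar>y k\<bar>) \<Longrightarrow> x \<in> d"
  using wbound_abs_mono[OF wbound_nm] lorentz_memI by blast

lemma nm_abs_mono: "y \<in> d \<Longrightarrow> (\<And>k. \<bar>x k\<bar> \<le> \<bar>y k\<bar>) \<Longrightarrow> nm x \<le> nm y"
  using wbound_abs_mono[OF wbound_nm] nm_leI nm_nonneg by blast

text \<open>A single coordinate may be assigned the weight \<open>w 0\<close>, which is 1.\<close>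

lemma coord_le_nm: "x \<in> d \<Longrightarrow> \<bar>x k\<bar> \<le> nm x"
  using wboundD[OF wbound_nm, of x "{k}" "\<lambda>_. 0"] w1 powr_p_le_iff[of "\<bar>x k\<bar>" "nm x"] nm_nonneg
  by simp

lemma wbound_scale: 
  assumes "wbound x C" shows "wbound (\<lambda>n. c * x n) (\<bar>c\<bar> powr p * C)"
proof (rule wboundI)
  fix I :: "nat set" and \<sigma> :: "nat \<Rightarrow> nat" assume I: "finite I" "inj_on \<sigma> I"
  have "(\<Sum>i\<in>I. w (\<sigma> i) * \<bar>c * x i\<bar> powr p) = \<bar>c\<bar> powr p * (\<Sum>i\<in>I. w (\<sigma> i) * \<bar>x i\<bar> powr p)"
    unfolding sum_distrib_left by (intro sum.cong) (auto simp: abs_mult powr_mult)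
  then show "(\<Sum>i\<in>I. w (\<sigma> i) * \<bar>c * x i\<bar> powr p) \<le> \<bar>c\<bar> powr p * C"
    using wboundD[OF assms I] by (simp add: mult_left_mono)
qed

lemma d_scale: "x \<in> d \<Longrightarrow> (\<lambda>n. c * x n) \<in> d"
  using wbound_scale[OF wbound_nm] lorentz_memI by blast

lemma nm_scale_le: "x \<in> d \<Longrightarrow> nm (\<lambda>n. c * x n) \<le> \<bar>c\<bar> * nm x"
  by (rule nm_leI) (use wbound_scale[OF wbound_nm] nm_nonneg in \<open>auto simp: powr_mult\<close>)

lemma nm_scale:
  assumes "x \<in> d"
  shows "nm (\<lambda>n. c * x n) = \<bar>c\<bar> * nm x"
proof (cases "c = 0")
  case True
  then show ?thesis using nm_scale_le[OF assms, of c] nm_nonneg by (simp add: order_antisym)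
next
  case False
  have "nm x \<le> \<bar>inverse c\<bar> * nm (\<lambda>n. c * x n)"
    using nm_scale_le[OF d_scale[OF assms, of c], of "inverse c"] False by (simp add: field_simps)
  then have "\<bar>c\<bar> * nm x \<le> nm (\<lambda>n. c * x n)" using False by (simp add: field_simps)
  then show ?thesis using nm_scale_le[OF assms, of c] by simp
qed

text \<open>Minkowski's inequality from convexity: (a + b)/(A + B) is a convex combination of a/A
  and b/B. Dividing by the bounds requires them to be positive, so the triangle inequality is
  obtained from slightly enlarged norms.\<close>

lemma wbound_add:
  assumes x: "wbound x (A powr p)" and y: "wbound y (B powr p)" and AB: "0 < A" "0 < B"
  shows "wbound (\<lambda>n. x n + y n) ((A + B) powr p)"
proof (rule wboundI)
  fix I :: "nat set" and \<sigma> :: "nat \<Rightarrow> nat" assume I: "finite I" "inj_on \<sigma> I"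
  let ?t = "B / (A + B)"
  have t: "0 \<le> ?t" "?t \<le> 1" "1 - ?t = A / (A + B)" using AB by (auto simp: field_simps)
  have pt: "\<bar>a + b\<bar> powr p \<le> (A + B) powr p * ((1 - ?t) * (\<bar>a\<bar> powr p / A powr p) + ?t * (\<bar>b\<bar> powr p / B powr p))"
    for a b :: real
  proof -
    have "((1 - ?t) *\<^sub>R (\<bar>a\<bar> / A) + ?t *\<^sub>R (\<bar>b\<bar> / B)) powr p
        \<le> (1 - ?t) * (\<bar>a\<bar> / A) powr p + ?t * (\<bar>b\<bar> / B) powr p"
      by (rule convex_onD[OF convex_on_powr_nonneg[OF p]]) (use AB t in auto)
    moreover have "(1 - ?t) *\<^sub>R (\<bar>a\<bar> / A) + ?t *\<^sub>R (\<bar>b\<bar> / B) = (\<bar>a\<bar> + \<bar>b\<bar>) / (A + B)"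
      using AB unfolding t(3) by (simp add: add_divide_distrib)
    ultimately have 1: "((\<bar>a\<bar> + \<bar>b\<bar>) / (A + B)) powr p
        \<le> (1 - ?t) * (\<bar>a\<bar> powr p / A powr p) + ?t * (\<bar>b\<bar> powr p / B powr p)"
      using AB by (simp add: powr_divide)
    have "\<bar>a + b\<bar> powr p \<le> (\<bar>a\<bar> + \<bar>b\<bar>) powr p" using p by (intro powr_mono2) auto
    also have "\<dots> = (A + B) powr p * ((\<bar>a\<bar> + \<bar>b\<bar>) / (A + B)) powr p"
      using AB by (simp add: powr_divide)
    also have "\<dots> \<le> (A + B) powr p * ((1 - ?t) * (\<bar>a\<bar> powr p / A powr p) + ?t * (\<bar>b\<bar> powr p / B powr p))"
      using 1 by (intro mult_left_mono) auto
    finally show ?thesis .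
  qed
  let ?X = "\<Sum>i\<in>I. w (\<sigma> i) * \<bar>x i\<bar> powr p" and ?Y = "\<Sum>i\<in>I. w (\<sigma> i) * \<bar>y i\<bar> powr p"
  have "(\<Sum>i\<in>I. w (\<sigma> i) * \<bar>x i + y i\<bar> powr p)
      \<le> (\<Sum>i\<in>I. w (\<sigma> i) * ((A + B) powr p * ((1 - ?t) * (\<bar>x i\<bar> powr p / A powr p) + ?t * (\<bar>y i\<bar> powr p / B powr p))))"
    by (intro sum_mono mult_left_mono pt w_nonneg)
  also have "\<dots> = (A + B) powr p * ((1 - ?t) * (?X / A powr p) + ?t * (?Y / B powr p))"
    by (simp add: sum_distrib_left sum_divide_distrib sum.distrib algebra_simps)
  also have "\<dots> \<le> (A + B) powr p * ((1 - ?t) * 1 + ?t * 1)"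
  proof (intro mult_left_mono add_mono)
    show "?X / A powr p \<le> 1" using wboundD[OF x I] AB by (simp add: divide_le_eq)
    show "?Y / B powr p \<le> 1" using wboundD[OF y I] AB by (simp add: divide_le_eq)
  qed (use t in auto)
  finally show "(\<Sum>i\<in>I. w (\<sigma> i) * \<bar>x i + y i\<bar> powr p) \<le> (A + B) powr p" by simp
qed

lemma d_add:
  assumes "x \<in> d" "y \<in> d"
  shows "(\<lambda>n. x n + y n) \<in> d"
  by (rule lorentz_memI, rule wbound_add[of _ "nm x + 1" _ "nm y + 1"])
    (use wbound_le assms nm_nonneg[of x] nm_nonneg[of y] in auto)

lemma nm_triangle:
  assumes "x \<in> d" "y \<in> d"
  shows "nm (\<lambda>n. x n + y n) \<le> nm x + nm y"
proof (rule field_le_epsilon)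
  fix e :: real assume "e > 0"
  have "nm (\<lambda>n. x n + y n) \<le> (nm x + e / 2) + (nm y + e / 2)"
    by (rule nm_leI, rule wbound_add)
      (use wbound_le assms nm_nonneg[of x] nm_nonneg[of y] \<open>e > 0\<close> in auto)
  then show "nm (\<lambda>n. x n + y n) \<le> nm x + nm y + e" by simp
qed

lemma d_zero: "(\<lambda>n. 0) \<in> d"
  by (rule lorentz_memI[of _ 0]) (auto intro: wboundI)

lemma nm_zero: "nm (\<lambda>n. 0) = 0"
  using nm_scale[OF d_zero, of 0] by simp

lemma d_diff: "x \<in> d \<Longrightarrow> y \<in> d \<Longrightarrow> (\<lambda>n. x n - y n) \<in> d"
  using d_add[of x "\<lambda>n. -1 * y n"] d_scale[of y "-1"] by simp

lemma nm_minus: "x \<in> d \<Longrightarrow> nm (\<lambda>n. - x n) = nm x"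
  using nm_scale[of x "-1"] by simp

lemma nm_diff_commute: "x \<in> d \<Longrightarrow> y \<in> d \<Longrightarrow> nm (\<lambda>n. x n - y n) = nm (\<lambda>n. y n - x n)"
  using nm_minus[OF d_diff, of x y] by simp

lemma nm_triangle_diff: "x \<in> d \<Longrightarrow> y \<in> d \<Longrightarrow> nm (\<lambda>n. x n - y n) \<le> nm x + nm y"
  using nm_triangle[of x "\<lambda>n. -1 * y n"] d_scale[of y "-1"] nm_minus[of y] by simp

lemma nm_triangle3:
  assumes "x \<in> d" "y \<in> d" "z \<in> d"
  shows "nm (\<lambda>n. x n - z n) \<le> nm (\<lambda>n. x n - y n) + nm (\<lambda>n. y n - z n)"
  using nm_triangle[OF d_diff[OF assms(1,2)] d_diff[OF assms(2,3)]] by simp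

text \<open>Each sum in \<open>wbound\<close> is finite and therefore survives a coordinatewise
  limit. The resulting lower semicontinuity of the norm takes the place of completeness and weak
  compactness arguments.\<close>

lemma wbound_limit:
  assumes "\<And>n. wbound (x n) C" "\<And>i. (\<lambda>n. x n i) \<longlonglongrightarrow> y i"
  shows "wbound y C"
proof (rule wboundI)
  fix I :: "nat set" and \<sigma> :: "nat \<Rightarrow> nat" assume I: "finite I" "inj_on \<sigma> I"
  have "(\<lambda>n. \<Sum>i\<in>I. w (\<sigma> i) * \<bar>x n i\<bar> powr p) \<longlonglongrightarrow> (\<Sum>i\<in>I. w (\<sigma> i) * \<bar>y i\<bar> powr p)"
    using p by (intro tendsto_intros tendsto_powr2 assms(2)) auto
  then show "(\<Sum>i\<in>I. w (\<sigma> i) * \<bar>y i\<bar> powr p) \<le> C"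
    by (rule LIMSEQ_le_const2) (use wboundD[OF assms(1) I] in auto)
qed

lemma fatou:
  assumes "\<And>n. x n \<in> d" "\<And>n. nm (x n) \<le> C" "\<And>i. (\<lambda>n. x n i) \<longlonglongrightarrow> y i"
  shows "y \<in> d" "nm y \<le> C"
proof -
  have "wbound y (C powr p)" by (rule wbound_limit[OF _ assms(3)]) (use assms wbound_le in blast)
  then show "y \<in> d" "nm y \<le> C" using lorentz_memI nm_leI order_trans[OF nm_nonneg assms(2)] by blast+
qed

text \<open>The rearrangement of a tail is bounded by that of \<open>x\<close>, whose series is
  small beyond rank \<open>N\<close>; at the first \<open>N\<close> ranks it is bounded by the
  largest entry left, which is small once enough coordinates are cut off.\<close>

lemma tail_small:
  assumes "x \<in> d" "e > 0"
  shows "\<exists>M0. \<forall>M\<ge>M0. nm (\<lambda>i. if i < M then 0 else x i) \<le> e"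
proof -
  have null: "x \<longlonglongrightarrow> 0" and sm: "summable (\<lambda>n. w n * rearr x n powr p)"
    using assms by (auto simp: lorentz_space_def)
  obtain B where B: "\<And>k. \<bar>x k\<bar> \<le> B" using null_seq_bounded[OF null] by blast
  let ?f = "\<lambda>n. w n * rearr x n powr p"
  have "0 < e powr p / 2" using assms by simp
  then obtain N where N: "\<And>m n. N \<le> m \<Longrightarrow> norm (sum ?f {m..<n}) < e powr p / 2"
    using sm unfolding summable_Cauchy by blast
  \<comment> \<open>Chosen so that \<open>N\<close> ranks of height \<open>\<eta>\<close> contribute
    at most half of \<open>e powr p\<close>; the summand 1 keeps the quotient defined when
    \<open>N\<close> is 0.\<close>
  define \<eta> where "\<eta> = (e powr p / 2 / (real N + 1)) powr (1 / p)"
  have \<eta>: "\<eta> > 0" "\<eta> powr p = e powr p / 2 / (real N + 1)" using assms p by (auto simp: \<eta>_def powr_powr)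
  obtain M0 where M0: "\<And>k. k \<ge> M0 \<Longrightarrow> \<bar>x k\<bar> < \<eta>" using LIMSEQ_D[OF null \<eta>(1)] by auto
  show ?thesis
  proof (intro exI[of _ M0] allI impI)
    fix M assume M: "M0 \<le> M"
    let ?t = "\<lambda>i. if i < M then 0 else x i"
    have t: "?t \<in> d" by (rule d_abs_mono[OF assms(1)]) auto
    have nn: "0 \<le> rearr ?t n" for n by (rule rearr_nonneg[of _ B]) (use B order_trans[OF abs_ge_zero B] in auto)
    have le1: "rearr ?t n \<le> rearr x n" for n by (rule rearr_mono[OF _ B]) auto
    have le2: "rearr ?t n \<le> \<eta>" for n
      by (rule rearr_le[of "{..<n}"]) (use \<eta> M0 M in \<open>auto intro!: less_imp_le\<close>)
    have "(\<Sum>n<K. w n * rearr ?t n powr p) \<le> e powr p" for K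
    proof -
      have "(\<Sum>n<K. w n * rearr ?t n powr p) \<le> (\<Sum>n<K + N. w n * rearr ?t n powr p)"
        by (rule sum_mono2) (use w_nonneg in auto)
      also have "\<dots> = (\<Sum>n<N. w n * rearr ?t n powr p) + (\<Sum>n\<in>{N..<K + N}. w n * rearr ?t n powr p)"
        by (subst sum.union_disjoint[symmetric]) (auto intro!: sum.cong)
      also have "(\<Sum>n\<in>{N..<K + N}. w n * rearr ?t n powr p) \<le> sum ?f {N..<K + N}"
        using le1 nn w_nonneg p by (intro sum_mono mult_left_mono powr_mono2) auto
      also have "\<dots> \<le> e powr p / 2" using N[of N "K + N"] by simp
      also have "(\<Sum>n<N. w n * rearr ?t n powr p) \<le> (\<Sum>n<N. 1 * \<eta> powr p)"
        using le2 nn w_nonneg w_le_1 p by (intro sum_mono mult_mono powr_mono2) auto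
      also have "\<dots> \<le> e powr p / 2" unfolding \<eta>(2) using assms by (simp add: field_simps)
      finally show ?thesis by simp
    qed
    then have "nm ?t powr p \<le> e powr p" unfolding nm_powr[OF t]
      using t by (intro suminf_le_const) (auto simp: lorentz_space_def)
    then show "nm ?t \<le> e" using powr_p_le_iff[OF nm_nonneg] assms(2) by simp
  qed
qed

lemma wbound_initial:
  assumes "\<And>i. \<bar>x i\<bar> \<le> c"
  shows "wbound (\<lambda>i. if i < M then x i else 0) (real M * c powr p)"
proof (rule wboundI)
  fix I :: "nat set" and \<sigma> :: "nat \<Rightarrow> nat" assume I: "finite I" "inj_on \<sigma> I"
  have "(\<Sum>i\<in>I. w (\<sigma> i) * \<bar>if i < M then x i else 0\<bar> powr p) = (\<Sum>i\<in>I \<inter> {..<M}. w (\<sigma> i) * \<bar>x i\<bar> powr p)"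
    by (rule sum.mono_neutral_cong_right) (use I p in auto)
  also have "\<dots> \<le> (\<Sum>i\<in>I \<inter> {..<M}. 1 * c powr p)"
    using assms w_nonneg w_le_1 p by (intro sum_mono mult_mono powr_mono2) auto
  also have "\<dots> \<le> real M * c powr p"
    using card_mono[of "{..<M}" "I \<inter> {..<M}"] by (simp add: mult_right_mono)
  finally show "(\<Sum>i\<in>I. w (\<sigma> i) * \<bar>if i < M then x i else 0\<bar> powr p) \<le> real M * c powr p" .
qed

end

subsection \<open>Operators\<close>

lemma bdd_op_zero:
  assumes "bdd_op X NX Y NY T"
  shows "T (\<lambda>n. 0) = (\<lambda>n. 0)"
proof (cases "(\<lambda>n. 0) \<in> X")
  case True
  then have "T (\<lambda>n. 0 * (0::real)) = (\<lambda>n. 0 * T (\<lambda>n. 0) n)"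
    using assms unfolding bdd_op_def by (elim conjE) (drule bspec, assumption, erule allE)
  then show ?thesis by simp
next
  case False
  then show ?thesis using assms unfolding bdd_op_def by blast
qed

lemma bdd_op_bound:
  assumes "bdd_op X NX Y NY T" "\<And>x. 0 \<le> NX x"
  obtains C where "C > 0" "\<And>x. x \<in> X \<Longrightarrow> NY (T x) \<le> C * NX x"
proof -
  obtain C where C: "\<forall>x\<in>X. NY (T x) \<le> C * NX x" using assms unfolding bdd_op_def by blast
  have "NY (T x) \<le> (\<bar>C\<bar> + 1) * NX x" if "x \<in> X" for x
    using C that mult_right_mono[OF _ assms(2), of C "\<bar>C\<bar> + 1" x] by force
  then show ?thesis by (intro that[of "\<bar>C\<bar> + 1"]) auto
qed

lemma bdd_op_comp:
  assumes S: "bdd_op X NX Y NY S" and T: "bdd_op Y NY Z NZ T"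
    and nn: "\<And>x. 0 \<le> NX x" "\<And>y. 0 \<le> NY y"
  shows "bdd_op X NX Z NZ (T \<circ> S)"
proof -
  obtain C where C: "C > 0" "\<And>x. x \<in> X \<Longrightarrow> NY (S x) \<le> C * NX x" using bdd_op_bound[OF S nn(1)] by blast
  obtain D where D: "D > 0" "\<And>x. x \<in> Y \<Longrightarrow> NZ (T x) \<le> D * NY x" using bdd_op_bound[OF T nn(2)] by blast
  have SY: "S x \<in> Y" if "x \<in> X" for x using S that unfolding bdd_op_def by blast
  have "NZ (T (S x)) \<le> D * C * NX x" if "x \<in> X" for x
    using order_trans[OF D(2)[OF SY[OF that]] mult_left_mono[OF C(2)[OF that], of D]] D(1) by (simp add: mult.assoc)
  moreover have "T (S x) = (\<lambda>n. 0)" if "x \<notin> X" for x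
    using S that bdd_op_zero[OF T] unfolding bdd_op_def by simp
  ultimately show ?thesis using S T unfolding bdd_op_def comp_def by (auto intro!: exI[of _ "D * C"])
qed

lemma lp_norm_nonneg: "0 \<le> lp_norm p x"
  by (simp add: lp_norm_def)

lemma lp_norm_powr: "p > 0 \<Longrightarrow> x \<in> lp_space p \<Longrightarrow> lp_norm p x powr p = (\<Sum>n. \<bar>x n\<bar> powr p)"
  by (auto simp: lp_norm_def powr_powr lp_space_def suminf_nonneg)

lemma lp_sum_le:
  assumes "p > 0" "x \<in> lp_space p" "finite I"
  shows "(\<Sum>i\<in>I. \<bar>x i\<bar> powr p) \<le> lp_norm p x powr p"
  unfolding lp_norm_powr[OF assms(1,2)] using assms by (intro sum_le_suminf) (auto simp: lp_space_def)

lemma lp_memI: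
  assumes "\<And>N. (\<Sum>n<N. \<bar>x n\<bar> powr p) \<le> C"
  shows "x \<in> lp_space p"
  unfolding lp_space_def using assms by (auto intro!: summableI_nonneg_bounded[of _ C])

lemma lp_norm_powr_le:
  assumes "p > 0" "\<And>N. (\<Sum>n<N. \<bar>x n\<bar> powr p) \<le> C"
  shows "lp_norm p x powr p \<le> C"
  unfolding lp_norm_powr[OF assms(1) lp_memI[OF assms(2)]]
  using assms lp_memI[OF assms(2)] by (intro suminf_le_const) (auto simp: lp_space_def)

section \<open>Operators on the Lorentz space and operators into lp\<close>

context lorentz_weight
begin

abbreviation "L \<equiv> Lop w p"
abbreviation "lp \<equiv> lp_space p"
abbreviation "lpn \<equiv> lp_norm p"

lemma lp_norm_leI:
  assumes "\<And>N. (\<Sum>n<N. \<bar>x n\<bar> powr p) \<le> C powr p" "0 \<le> C"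
  shows "lpn x \<le> C"
  using lp_norm_powr_le[OF p_pos assms(1)] powr_p_le_iff[OF lp_norm_nonneg assms(2)] by blast

lemma wbound_lp: 
  assumes "x \<in> lp" shows "wbound x (lpn x powr p)"
proof (rule wboundI)
  fix I :: "nat set" and \<sigma> :: "nat \<Rightarrow> nat" assume I: "finite I" "inj_on \<sigma> I"
  have "(\<Sum>i\<in>I. w (\<sigma> i) * \<bar>x i\<bar> powr p) \<le> (\<Sum>i\<in>I. 1 * \<bar>x i\<bar> powr p)"
    using w_le_1 by (intro sum_mono mult_right_mono) auto
  also have "\<dots> \<le> lpn x powr p" using lp_sum_le[OF p_pos assms I(1)] by simp
  finally show "(\<Sum>i\<in>I. w (\<sigma> i) * \<bar>x i\<bar> powr p) \<le> lpn x powr p" .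
qed

lemma lp_subset_d: "x \<in> lp \<Longrightarrow> x \<in> d"
  using wbound_lp lorentz_memI by blast

lemma nm_le_lp: "x \<in> lp \<Longrightarrow> nm x \<le> lpn x"
  using wbound_lp nm_leI lp_norm_nonneg by blast

lemma LopI:
  assumes "\<And>x. x \<in> d \<Longrightarrow> T x \<in> d"
    and "\<And>x y. x \<in> d \<Longrightarrow> y \<in> d \<Longrightarrow> T (\<lambda>n. x n + y n) = (\<lambda>n. T x n + T y n)"
    and "\<And>x c. x \<in> d \<Longrightarrow> T (\<lambda>n. c * x n) = (\<lambda>n. c * T x n)"
    and "\<And>x. x \<in> d \<Longrightarrow> nm (T x) \<le> C * nm x"
    and "\<And>x. x \<notin> d \<Longrightarrow> T x = (\<lambda>n. 0)"
  shows "T \<in> L"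
  using assms unfolding Lop_def bdd_op_def by blast

lemma LopD: "T \<in> L \<Longrightarrow> bdd_op d nm d nm T"
  by (simp add: Lop_def)

lemma Lop_mem: "T \<in> L \<Longrightarrow> x \<in> d \<Longrightarrow> T x \<in> d"
  and Lop_add: "T \<in> L \<Longrightarrow> x \<in> d \<Longrightarrow> y \<in> d \<Longrightarrow> T (\<lambda>n. x n + y n) = (\<lambda>n. T x n + T y n)"
  and Lop_scale: "T \<in> L \<Longrightarrow> x \<in> d \<Longrightarrow> T (\<lambda>n. c * x n) = (\<lambda>n. c * T x n)"
  and Lop_outside: "T \<in> L \<Longrightarrow> x \<notin> d \<Longrightarrow> T x = (\<lambda>n. 0)"
  unfolding Lop_def bdd_op_def by blast+

lemma Lop_bound:
  assumes "T \<in> L"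
  obtains C where "C > 0" "\<And>x. x \<in> d \<Longrightarrow> nm (T x) \<le> C * nm x"
  using bdd_op_bound[OF LopD[OF assms] nm_nonneg] by blast

lemma Lop_zero: "T \<in> L \<Longrightarrow> T (\<lambda>n. 0) = (\<lambda>n. 0)"
  by (rule bdd_op_zero[OF LopD])

lemma Lop_diff:
  assumes "T \<in> L" "x \<in> d" "y \<in> d"
  shows "T (\<lambda>n. x n - y n) = (\<lambda>n. T x n - T y n)"
proof -
  have "(\<lambda>n. - 1 * y n) \<in> d" by (rule d_scale[OF assms(3)])
  from Lop_add[OF assms(1,2) this] show ?thesis
    using Lop_scale[OF assms(1,3), of "- 1"] by simp
qed

lemma d_sum: "(\<And>k::nat. k < n \<Longrightarrow> u k \<in> d) \<Longrightarrow> (\<lambda>i. \<Sum>k<n. a k * u k i) \<in> d"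
proof (induction n)
  case (Suc n)
  then show ?case using d_add[of "\<lambda>i. \<Sum>k<n. a k * u k i" "\<lambda>i. a n * u n i"] d_scale[of "u n" "a n"]
    by simp
qed (simp add: d_zero)

lemma Lop_sum:
  assumes "T \<in> L"
  shows "(\<And>k::nat. k < n \<Longrightarrow> u k \<in> d) \<Longrightarrow> T (\<lambda>i. \<Sum>k<n. a k * u k i) = (\<lambda>i. \<Sum>k<n. a k * T (u k) i)"
proof (induction n)
  case 0
  then show ?case using Lop_zero[OF assms] by simp
next
  case (Suc n)
  then have "(\<lambda>i. \<Sum>k<n. a k * u k i) \<in> d" "(\<lambda>i. a n * u n i) \<in> d"
    by (auto intro!: d_sum d_scale)
  from Lop_add[OF assms this] show ?case using Suc Lop_scale[OF assms, of "u n" "a n"] by simp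
qed

lemma nm_sum_le: "(\<And>k::nat. k < n \<Longrightarrow> u k \<in> d) \<Longrightarrow> nm (\<lambda>i. \<Sum>k<n. a k * u k i) \<le> (\<Sum>k<n. \<bar>a k\<bar> * nm (u k))"
proof (induction n)
  case 0
  then show ?case using nm_zero by simp
next
  case (Suc n)
  then have "(\<lambda>i. \<Sum>k<n. a k * u k i) \<in> d" "(\<lambda>i. a n * u n i) \<in> d"
    by (auto intro!: d_sum d_scale)
  from nm_triangle[OF this] show ?case using Suc nm_scale[of "u n" "a n"] by fastforce
qed

lemma Lop_comp: "S \<in> L \<Longrightarrow> T \<in> L \<Longrightarrow> T \<circ> S \<in> L"
  unfolding Lop_def using bdd_op_comp nm_nonneg by blast

lemma Lop_plus:
  assumes "S \<in> L" "T \<in> L"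
  shows "(\<lambda>x n. S x n + T x n) \<in> L"
proof -
  obtain C D where C: "\<And>x. x \<in> d \<Longrightarrow> nm (S x) \<le> C * nm x" and D: "\<And>x. x \<in> d \<Longrightarrow> nm (T x) \<le> D * nm x"
    using Lop_bound[OF assms(1)] Lop_bound[OF assms(2)] by metis
  show ?thesis
  proof (rule LopI[of _ "C + D"])
    fix x assume x: "x \<in> d"
    show "(\<lambda>n. S x n + T x n) \<in> d" using assms x by (intro d_add Lop_mem[OF _ x])
    show "nm (\<lambda>n. S x n + T x n) \<le> (C + D) * nm x"
      using nm_triangle[OF Lop_mem[OF assms(1) x] Lop_mem[OF assms(2) x]] C[OF x] D[OF x]
      by (simp add: distrib_right)
  qed (use assms in \<open>auto simp: Lop_add Lop_scale Lop_outside algebra_simps\<close>)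
qed

lemma Lop_times:
  assumes "S \<in> L"
  shows "(\<lambda>x n. c * S x n) \<in> L"
proof -
  obtain C where C: "\<And>x. x \<in> d \<Longrightarrow> nm (S x) \<le> C * nm x" using Lop_bound[OF assms] by metis
  show ?thesis
  proof (rule LopI[of _ "\<bar>c\<bar> * C"])
    fix x assume x: "x \<in> d"
    show "(\<lambda>n. c * S x n) \<in> d" using assms x by (intro d_scale Lop_mem[OF _ x])
    show "nm (\<lambda>n. c * S x n) \<le> \<bar>c\<bar> * C * nm x"
      using nm_scale[OF Lop_mem[OF assms x], of c] C[OF x] mult_left_mono[of _ _ "\<bar>c\<bar>"] by force
  qed (use assms in \<open>auto simp: Lop_add Lop_scale Lop_outside algebra_simps\<close>)
qed

lemma Lop_op_diff: "S \<in> L \<Longrightarrow> T \<in> L \<Longrightarrow> op_diff S T \<in> L"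
  using Lop_plus[OF _ Lop_times[of T "-1"]] by (simp add: op_diff_def)

lemma nm_eq_0: "x \<in> d \<Longrightarrow> nm x = 0 \<Longrightarrow> x = (\<lambda>n. 0)"
  using coord_le_nm by force

lemma le_dopnorm:
  assumes "T \<in> L" "x \<in> d"
  shows "nm (T x) \<le> dopnorm w p T * nm x"
proof (cases "nm x = 0")
  case True
  then show ?thesis using nm_eq_0[OF assms(2)] Lop_zero[OF assms(1)] nm_zero by simp
next
  case False
  then have pos: "nm x > 0" using nm_nonneg[of x] by simp
  let ?y = "\<lambda>n. inverse (nm x) * x n"
  obtain C where C: "C > 0" "\<And>x. x \<in> d \<Longrightarrow> nm (T x) \<le> C * nm x" using Lop_bound[OF assms(1)] by metis
  have bdd: "bdd_above ((\<lambda>x. nm (T x)) ` {x \<in> d. nm x \<le> 1})"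
  proof (rule bdd_aboveI2)
    fix x assume x: "x \<in> {x \<in> d. nm x \<le> 1}"
    then have "nm (T x) \<le> C * nm x" using C by blast
    also have "\<dots> \<le> C * 1" using x C(1) by (intro mult_left_mono) auto
    finally show "nm (T x) \<le> C" by simp
  qed
  have y: "?y \<in> d" "nm ?y = 1" using d_scale[OF assms(2)] nm_scale[OF assms(2)] pos by auto
  have "nm (T ?y) \<le> dopnorm w p T"
    unfolding dopnorm_def opnorm_def using y by (intro cSUP_upper[OF _ bdd]) auto
  moreover have "nm (T ?y) = inverse (nm x) * nm (T x)"
    using Lop_scale[OF assms] nm_scale[OF Lop_mem[OF assms]] pos by simp
  ultimately have "inverse (nm x) * nm (T x) \<le> dopnorm w p T" by simp
  then show ?thesis using pos by (simp add: field_simps)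
qed

lemma dopnorm_le:
  assumes "0 \<le> C" "\<And>x. x \<in> d \<Longrightarrow> nm (T x) \<le> C * nm x"
  shows "dopnorm w p T \<le> C"
  unfolding dopnorm_def opnorm_def
proof (rule cSUP_least)
  show "{x \<in> d. nm x \<le> 1} \<noteq> {}" using d_zero nm_zero by force
  fix x assume x: "x \<in> {x \<in> d. nm x \<le> 1}"
  then have "nm (T x) \<le> C * nm x" using assms by blast
  also have "\<dots> \<le> C * 1" using x assms(1) by (intro mult_left_mono) auto
  finally show "nm (T x) \<le> C" by simp
qed

text \<open>Distance at most \<open>e\<close> in operator norm, written pointwise so that the
  supremum in \<open>opnorm\<close> and its boundedness conditions are handled only once, in
  \<open>approx_iff\<close>.\<close>

definition near :: "real \<Rightarrow> (rseq \<Rightarrow> rseq) \<Rightarrow> (rseq \<Rightarrow> rseq) \<Rightarrow> bool" where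
  "near e T S \<longleftrightarrow> (\<forall>x\<in>d. nm (\<lambda>n. T x n - S x n) \<le> e * nm x)"

lemma approx_iff:
  assumes "T \<in> L" "J \<subseteq> L"
  shows "(\<forall>e>0. \<exists>S\<in>J. dopnorm w p (op_diff T S) < e) \<longleftrightarrow> (\<forall>e>0. \<exists>S\<in>J. near e T S)"
proof (intro iffI allI impI)
  fix e :: real assume e: "e > 0" and *: "\<forall>e>0. \<exists>S\<in>J. dopnorm w p (op_diff T S) < e"
  then obtain S where S: "S \<in> J" "dopnorm w p (op_diff T S) < e" by blast
  have "nm (\<lambda>n. T x n - S x n) \<le> e * nm x" if "x \<in> d" for x
  proof -
    have "nm (op_diff T S x) \<le> dopnorm w p (op_diff T S) * nm x"
      by (rule le_dopnorm[OF Lop_op_diff that]) (use assms S in auto)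
    also have "\<dots> \<le> e * nm x" using S nm_nonneg by (intro mult_right_mono) auto
    finally show ?thesis by (simp add: op_diff_def)
  qed
  then show "\<exists>S\<in>J. near e T S" using S(1) by (auto simp: near_def)
next
  fix e :: real assume e: "e > 0" and *: "\<forall>e>0. \<exists>S\<in>J. near e T S"
  \<comment> \<open>Halving \<open>e\<close> turns the weak bound into the strict one.\<close>
  then obtain S where S: "S \<in> J" "near (e / 2) T S" using half_gt_zero by blast
  have "dopnorm w p (op_diff T S) \<le> e / 2"
    using e S(2) by (intro dopnorm_le) (auto simp: near_def op_diff_def)
  then show "\<exists>S\<in>J. dopnorm w p (op_diff T S) < e" using S(1) e by force
qed

lemma near_comp:
  assumes "near e T S" "T \<in> L" "S \<in> L" "A \<in> L" "B \<in> L"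
    and a: "\<And>x. x \<in> d \<Longrightarrow> nm (A x) \<le> a * nm x" "0 \<le> a"
    and b: "\<And>x. x \<in> d \<Longrightarrow> nm (B x) \<le> b * nm x" and e: "0 \<le> e"
  shows "near (a * e * b) (A \<circ> T \<circ> B) (A \<circ> S \<circ> B)"
  unfolding near_def
proof
  fix x assume x: "x \<in> d"
  then have Bx: "B x \<in> d" using Lop_mem assms by blast
  then have T: "T (B x) \<in> d" "S (B x) \<in> d" using Lop_mem assms by blast+
  have "nm (\<lambda>n. A (T (B x)) n - A (S (B x)) n) = nm (A (\<lambda>n. T (B x) n - S (B x) n))"
    using Lop_diff[OF assms(4) T] by simp
  also have "\<dots> \<le> a * nm (\<lambda>n. T (B x) n - S (B x) n)" using a d_diff[OF T] by blast
  also have "\<dots> \<le> a * (e * nm (B x))" using assms(1) Bx a(2) by (intro mult_left_mono) (auto simp: near_def)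
  also have "\<dots> \<le> a * (e * (b * nm x))" using b[OF x] a(2) e by (intro mult_left_mono) auto
  finally show "nm (\<lambda>n. (A \<circ> T \<circ> B) x n - (A \<circ> S \<circ> B) x n) \<le> a * e * b * nm x"
    by (simp add: mult.assoc)
qed

lemma LlpI:
  assumes "\<And>x. x \<in> d \<Longrightarrow> B x \<in> lp"
    and "\<And>x y. x \<in> d \<Longrightarrow> y \<in> d \<Longrightarrow> B (\<lambda>n. x n + y n) = (\<lambda>n. B x n + B y n)"
    and "\<And>x c. x \<in> d \<Longrightarrow> B (\<lambda>n. c * x n) = (\<lambda>n. c * B x n)"
    and "\<And>x. x \<in> d \<Longrightarrow> lpn (B x) \<le> C * nm x"
    and "\<And>x. x \<notin> d \<Longrightarrow> B x = (\<lambda>n. 0)"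
  shows "B \<in> Lop_lp w p"
  using assms unfolding Lop_lp_def bdd_op_def by blast

lemma Llp_mem: 
  assumes "B \<in> Lop_lp w p" shows "B x \<in> lp"
proof (cases "x \<in> d")
  case False
  then have "B x = (\<lambda>n. 0)" using assms by (auto simp: Lop_lp_def bdd_op_def)
  then show ?thesis using p by (simp add: lp_space_def)
qed (use assms in \<open>auto simp: Lop_lp_def bdd_op_def\<close>)

lemma Llp_bound:
  assumes "B \<in> Lop_lp w p"
  obtains C where "C > 0" "\<And>x. x \<in> d \<Longrightarrow> lpn (B x) \<le> C * nm x"
proof -
  have "bdd_op d nm lp lpn B" using assms by (simp add: Lop_lp_def)
  from bdd_op_bound[OF this nm_nonneg] that show ?thesis by blast
qed

lemma Llp_Lop:
  assumes "B \<in> Lop_lp w p" shows "B \<in> L"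
proof -
  obtain C where C: "C > 0" "\<And>x. x \<in> d \<Longrightarrow> lpn (B x) \<le> C * nm x" by (rule Llp_bound[OF assms]) blast
  have "nm (B x) \<le> C * nm x" if "x \<in> d" for x
    using nm_le_lp[OF Llp_mem[OF assms]] C(2)[OF that] order_trans by blast
  then show ?thesis
    by (intro LopI[of _ C]) (use assms lp_subset_d in \<open>auto simp: Lop_lp_def bdd_op_def\<close>)
qed

lemma Llp_comp: "S \<in> L \<Longrightarrow> B \<in> Lop_lp w p \<Longrightarrow> B \<circ> S \<in> Lop_lp w p"
  unfolding Lop_def Lop_lp_def using bdd_op_comp nm_nonneg by blast

text \<open>Operators into lp take all their values in lp, also off the domain where they are 0, and
  there \<open>formal_id\<close> is literally the identity. What remains of the factorization is
  boundedness of \<open>B\<close> in the stronger norm.\<close>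

lemma Jj_iff: "T \<in> Jj w p \<longleftrightarrow> (\<exists>A\<in>L. \<exists>B\<in>Lop_lp w p. T = A \<circ> B)"
proof -
  have "A \<circ> formal_id p \<circ> B = A \<circ> B" if "B \<in> Lop_lp w p" for A :: "rseq \<Rightarrow> rseq" and B
    using Llp_mem[OF that] by (simp add: fun_eq_iff formal_id_def)
  then show ?thesis unfolding Jj_def by force
qed

section \<open>The closed ideal generated by the formal identity\<close>

lemma Jj_subset: "Jj w p \<subseteq> L"
  using Lop_comp Llp_Lop by (auto simp: Jj_iff)

lemma Lop_zero_op: "(\<lambda>x n. 0) \<in> L"
  by (rule LopI[of _ 0]) (auto simp: d_zero nm_zero)

lemma Llp_zero_op: "(\<lambda>x n. 0) \<in> Lop_lp w p"
  by (rule LlpI[of _ 0]) (use p in \<open>auto simp: lp_space_def lp_norm_def\<close>)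

lemma wbound_subseq:
  assumes "wbound x C" "inj g"
  shows "wbound (\<lambda>n. x (g n)) C"
proof (rule wboundI)
  fix I :: "nat set" and \<sigma> :: "nat \<Rightarrow> nat" assume I: "finite I" "inj_on \<sigma> I"
  have "(\<Sum>i\<in>I. w (\<sigma> i) * \<bar>x (g i)\<bar> powr p) = (\<Sum>i\<in>g ` I. w (\<sigma> (inv g i)) * \<bar>x i\<bar> powr p)"
    using assms(2) by (subst sum.reindex) (auto intro: inj_on_subset)
  also have "\<dots> \<le> C"
    using I assms(2) by (intro wboundD[OF assms(1), of _ "\<lambda>i. \<sigma> (inv g i)"]) (auto simp: inj_on_def)
  finally show "(\<Sum>i\<in>I. w (\<sigma> i) * \<bar>x (g i)\<bar> powr p) \<le> C" .
qed

lemma d_subseq: "x \<in> d \<Longrightarrow> inj g \<Longrightarrow> (\<lambda>n. x (g n)) \<in> d"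
  using wbound_subseq[OF wbound_nm] lorentz_memI by blast

lemma nm_subseq: "x \<in> d \<Longrightarrow> inj g \<Longrightarrow> nm (\<lambda>n. x (g n)) \<le> nm x"
  using wbound_subseq[OF wbound_nm] nm_leI nm_nonneg by blast

lemma Jj_zero: "(\<lambda>x n. 0) \<in> Jj w p"
  unfolding Jj_iff using Lop_zero_op Llp_zero_op by (force simp: comp_def)

lemma Jj_times: "S \<in> Jj w p \<Longrightarrow> (\<lambda>x n. c * S x n) \<in> Jj w p"
  unfolding Jj_iff by (force intro: Lop_times simp: comp_def)

lemma Jj_comp:
  assumes "S \<in> Jj w p" "A \<in> L" "B \<in> L"
  shows "A \<circ> S \<circ> B \<in> Jj w p"
proof -
  obtain A' B' where "A' \<in> L" "B' \<in> Lop_lp w p" "S = A' \<circ> B'" using assms(1) Jj_iff by blast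
  then have "A \<circ> A' \<in> L" "B' \<circ> B \<in> Lop_lp w p" "A \<circ> S \<circ> B = (A \<circ> A') \<circ> (B' \<circ> B)"
    using Lop_comp Llp_comp assms by auto
  then show ?thesis unfolding Jj_iff by blast
qed

text \<open>Interleaving two sequences identifies lp with its square, compatibly with the
  corresponding splitting of the Lorentz space.\<close>

lemma Jj_plus:
  assumes "S \<in> Jj w p" "T \<in> Jj w p"
  shows "(\<lambda>x n. S x n + T x n) \<in> Jj w p"
proof -
  obtain A1 B1 where 1: "A1 \<in> L" "B1 \<in> Lop_lp w p" "S = A1 \<circ> B1" using assms(1) Jj_iff by blast
  obtain A2 B2 where 2: "A2 \<in> L" "B2 \<in> Lop_lp w p" "T = A2 \<circ> B2" using assms(2) Jj_iff by blast
  obtain b1 where b1: "b1 > 0" "\<And>x. x \<in> d \<Longrightarrow> lpn (B1 x) \<le> b1 * nm x" by (rule Llp_bound[OF 1(2)]) blast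
  obtain b2 where b2: "b2 > 0" "\<And>x. x \<in> d \<Longrightarrow> lpn (B2 x) \<le> b2 * nm x" by (rule Llp_bound[OF 2(2)]) blast
  let ?ev = "\<lambda>y::rseq. (\<lambda>n. y (2 * n))" and ?od = "\<lambda>y::rseq. (\<lambda>n. y (2 * n + 1))"
  define E where "E = (\<lambda>y. if y \<in> d then ?ev y else (\<lambda>n. 0))"
  define O' where "O' = (\<lambda>y. if y \<in> d then ?od y else (\<lambda>n. 0))"
  have inj: "inj (\<lambda>n::nat. 2 * n)" "inj (\<lambda>n::nat. 2 * n + 1)" by (auto simp: inj_on_def)
  have E: "E \<in> L"
    by (rule LopI[of _ 1]) (use d_subseq nm_subseq inj in \<open>auto simp: E_def d_add d_scale\<close>)
  have O: "O' \<in> L"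
    by (rule LopI[of _ 1]) (use d_subseq nm_subseq inj in \<open>auto simp: O'_def d_add d_scale\<close>)
  define A where "A = (\<lambda>y n. (A1 \<circ> E) y n + (A2 \<circ> O') y n)"
  have A: "A \<in> L" unfolding A_def using 1 2 E O by (intro Lop_plus Lop_comp)
  define B where "B = (\<lambda>x n. if even n then B1 x (n div 2) else B2 x (n div 2))"
  have sum2: "(\<Sum>n<N. \<bar>B x n\<bar> powr p) \<le> (b1 * nm x) powr p + (b2 * nm x) powr p" if "x \<in> d" for x N
  proof -
    have "(\<Sum>n<N. \<bar>B x n\<bar> powr p) \<le> (\<Sum>n<2 * N. \<bar>B x n\<bar> powr p)"
      by (rule sum_mono2) auto
    also have "\<dots> = (\<Sum>n<N. \<bar>B1 x n\<bar> powr p) + (\<Sum>n<N. \<bar>B2 x n\<bar> powr p)"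
      by (induction N) (auto simp: B_def)
    also have "\<dots> \<le> lpn (B1 x) powr p + lpn (B2 x) powr p"
      by (intro add_mono lp_sum_le p_pos Llp_mem 1 2) auto
    also have "\<dots> \<le> (b1 * nm x) powr p + (b2 * nm x) powr p"
      using b1(2)[OF that] b2(2)[OF that] p lp_norm_nonneg by (intro add_mono powr_mono2) auto
    finally show ?thesis .
  qed
  have lin: "bdd_op d nm lp lpn B1" "bdd_op d nm lp lpn B2" using 1 2 by (auto simp: Lop_lp_def)
  have B: "B \<in> Lop_lp w p"
  proof (rule LlpI[of _ "(b1 powr p + b2 powr p) powr (1 / p)"])
    fix x assume x: "x \<in> d"
    show "B x \<in> lp" using lp_memI[of "B x"] sum2[OF x] by blast
    \<comment> \<open>The p-th powers of the even and odd parts add, so the bound for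
      \<open>B\<close> is the lp-sum of \<open>b1\<close> and \<open>b2\<close>.\<close>
    have "((b1 powr p + b2 powr p) powr (1 / p) * nm x) powr p = (b1 * nm x) powr p + (b2 * nm x) powr p"
      using b1(1) b2(1) p nm_nonneg by (simp add: powr_mult powr_powr distrib_right)
    then show "lpn (B x) \<le> (b1 powr p + b2 powr p) powr (1 / p) * nm x"
      using sum2[OF x] by (intro lp_norm_leI) (auto simp: nm_nonneg)
  next
    fix x y assume "x \<in> d" "y \<in> d"
    then have "B1 (\<lambda>n. x n + y n) = (\<lambda>n. B1 x n + B1 y n)" "B2 (\<lambda>n. x n + y n) = (\<lambda>n. B2 x n + B2 y n)"
      using lin unfolding bdd_op_def by blast+
    then show "B (\<lambda>n. x n + y n) = (\<lambda>n. B x n + B y n)" by (auto simp: B_def)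
  next
    fix x c assume "x \<in> d"
    then have "B1 (\<lambda>n. c * x n) = (\<lambda>n. c * B1 x n)" "B2 (\<lambda>n. c * x n) = (\<lambda>n. c * B2 x n)"
      using lin unfolding bdd_op_def by blast+
    then show "B (\<lambda>n. c * x n) = (\<lambda>n. c * B x n)" by (auto simp: B_def)
  next
    fix x assume "x \<notin> d"
    then have "B1 x = (\<lambda>n. 0)" "B2 x = (\<lambda>n. 0)" using lin unfolding bdd_op_def by blast+
    then show "B x = (\<lambda>n. 0)" by (auto simp: B_def)
  qed
  have "?ev (B x) = B1 x" "?od (B x) = B2 x" for x by (auto simp: B_def)
  then have "(\<lambda>x n. S x n + T x n) = A \<circ> B"
    using lp_subset_d[OF Llp_mem[OF B]] by (simp add: fun_eq_iff A_def E_def O'_def 1(3) 2(3))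
  then show ?thesis unfolding Jj_iff using A B by blast
qed

lemma Jj_closure_iff: "T \<in> Jj_closure w p \<longleftrightarrow> T \<in> L \<and> (\<forall>e>0. \<exists>S\<in>Jj w p. near e T S)"
  unfolding Jj_closure_def using approx_iff[OF _ Jj_subset] by blast

lemma near_trans:
  assumes "near e T S" "near f S R" "T \<in> L" "S \<in> L" "R \<in> L"
  shows "near (e + f) T R"
  unfolding near_def
proof
  fix x assume x: "x \<in> d"
  have "nm (\<lambda>n. T x n - R x n) \<le> nm (\<lambda>n. T x n - S x n) + nm (\<lambda>n. S x n - R x n)"
    using assms x by (intro nm_triangle3 Lop_mem[OF _ x])
  also have "\<dots> \<le> e * nm x + f * nm x" using assms(1,2) x by (intro add_mono) (auto simp: near_def)
  finally show "nm (\<lambda>n. T x n - R x n) \<le> (e + f) * nm x" by (simp add: distrib_right)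
qed

lemma closed_ideal_Jj_closure: "closed_ideal w p (Jj_closure w p)"
  unfolding closed_ideal_def
proof (intro conjI ballI allI impI)
  show sub: "Jj_closure w p \<subseteq> L" by (auto simp: Jj_closure_iff)
  show "(\<lambda>x n. 0) \<in> Jj_closure w p"
    unfolding Jj_closure_iff
    by (intro conjI allI impI Lop_zero_op bexI[OF _ Jj_zero]) (simp add: near_def nm_zero nm_nonneg)
  fix S assume S: "S \<in> Jj_closure w p"
  then have SL: "S \<in> L" using sub by blast
  {
    fix T assume T: "T \<in> Jj_closure w p"
    then have TL: "T \<in> L" using sub by blast
    show "(\<lambda>x n. S x n + T x n) \<in> Jj_closure w p"
      unfolding Jj_closure_iff
    proof (intro conjI allI impI Lop_plus SL TL)
      fix e :: real assume e: "e > 0"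
      obtain S' where S': "S' \<in> Jj w p" "near (e / 2) S S'" using S e Jj_closure_iff half_gt_zero by blast
      obtain T' where T': "T' \<in> Jj w p" "near (e / 2) T T'" using T e Jj_closure_iff half_gt_zero by blast
      have L': "S' \<in> L" "T' \<in> L" using S' T' Jj_subset by auto
      have "near e (\<lambda>x n. S x n + T x n) (\<lambda>x n. S' x n + T' x n)"
        unfolding near_def
      proof
        fix x assume x: "x \<in> d"
        have "nm (\<lambda>n. (S x n - S' x n) + (T x n - T' x n)) \<le> nm (\<lambda>n. S x n - S' x n) + nm (\<lambda>n. T x n - T' x n)"
          using SL TL L' x by (intro nm_triangle d_diff Lop_mem[OF _ x])
        also have "\<dots> \<le> e / 2 * nm x + e / 2 * nm x"
          using S'(2) T'(2) x unfolding near_def by (intro add_mono) blast+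
        finally show "nm (\<lambda>n. S x n + T x n - (S' x n + T' x n)) \<le> e * nm x" by (simp add: algebra_simps)
      qed
      then show "\<exists>R\<in>Jj w p. near e (\<lambda>x n. S x n + T x n) R" using Jj_plus S' T' by blast
    qed
  next
    fix c :: real
    show "(\<lambda>x n. c * S x n) \<in> Jj_closure w p"
      unfolding Jj_closure_iff
    proof (intro conjI allI impI Lop_times SL)
      fix e :: real assume e: "e > 0"
      \<comment> \<open>The added 1 covers the case \<open>c = 0\<close>.\<close>
      then have "0 < e / (\<bar>c\<bar> + 1)" by simp
      then obtain S' where S': "S' \<in> Jj w p" "near (e / (\<bar>c\<bar> + 1)) S S'" using S Jj_closure_iff by blast
      have L': "S' \<in> L" using S' Jj_subset by auto
      have "near e (\<lambda>x n. c * S x n) (\<lambda>x n. c * S' x n)"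
        unfolding near_def
      proof
        fix x assume x: "x \<in> d"
        have "nm (\<lambda>n. c * (S x n - S' x n)) = \<bar>c\<bar> * nm (\<lambda>n. S x n - S' x n)"
          using SL L' x by (intro nm_scale d_diff Lop_mem[OF _ x])
        also have "\<dots> \<le> (\<bar>c\<bar> + 1) * (e / (\<bar>c\<bar> + 1) * nm x)"
          using S'(2) x nm_nonneg unfolding near_def by (intro mult_mono) auto
        also have "\<dots> = e * nm x" by (simp add: field_simps)
        finally show "nm (\<lambda>n. c * S x n - c * S' x n) \<le> e * nm x" by (simp add: algebra_simps)
      qed
      then show "\<exists>R\<in>Jj w p. near e (\<lambda>x n. c * S x n) R" using Jj_times S' by blast
    qed
  next
    fix A B assume A: "A \<in> L" and B: "B \<in> L"
    show "A \<circ> S \<circ> B \<in> Jj_closure w p"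
      unfolding Jj_closure_iff
    proof (intro conjI allI impI)
      show "A \<circ> S \<circ> B \<in> L" using A B SL Lop_comp by blast
      fix e :: real assume e: "e > 0"
      obtain a where a: "a > 0" "\<And>x. x \<in> d \<Longrightarrow> nm (A x) \<le> a * nm x" by (rule Lop_bound[OF A]) blast
      obtain b where b: "b > 0" "\<And>x. x \<in> d \<Longrightarrow> nm (B x) \<le> b * nm x" by (rule Lop_bound[OF B]) blast
      have pos: "0 < e / (a * b)" using e a b by simp
      then obtain S' where S': "S' \<in> Jj w p" "near (e / (a * b)) S S'" using S Jj_closure_iff by blast
      have L': "S' \<in> L" using S' Jj_subset by auto
      have "near (a * (e / (a * b)) * b) (A \<circ> S \<circ> B) (A \<circ> S' \<circ> B)"
        using near_comp[OF S'(2) SL L' A B a(2) _ b(2)] a(1) pos by simp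
      moreover have "a * (e / (a * b)) * b = e" using a b by simp
      ultimately show "\<exists>R\<in>Jj w p. near e (A \<circ> S \<circ> B) R" using Jj_comp[OF S'(1) A B] by auto
    qed
  }
next
  fix T assume T: "T \<in> L" and *: "\<forall>e>0. \<exists>S\<in>Jj_closure w p. dopnorm w p (op_diff T S) < e"
  have sub: "Jj_closure w p \<subseteq> L" by (auto simp: Jj_closure_iff)
  show "T \<in> Jj_closure w p"
    unfolding Jj_closure_iff
  proof (intro conjI allI impI T)
    fix e :: real assume e: "e > 0"
    obtain S where S: "S \<in> Jj_closure w p" "near (e / 2) T S"
      using * e approx_iff[OF T sub] half_gt_zero by blast
    obtain R where R: "R \<in> Jj w p" "near (e / 2) S R" using S e Jj_closure_iff half_gt_zero by blast
    have "near (e / 2 + e / 2) T R" using near_trans[OF S(2) R(2) T] S R sub Jj_subset by blast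
    then show "\<exists>S\<in>Jj w p. near e T S" using R(1) by auto
  qed
qed

text \<open>Truncation to the first N coordinates factors through lp, since finitely many
  coordinates are bounded by the norm. If these truncations stayed away from \<open>T\<close>, there
  would be unit ball vectors \<open>x N\<close> whose images have tails larger than \<open>e\<close>
  beyond N; a norm limit of a subsequence of the images would inherit large tails, against
  \<open>tail_small\<close>.\<close>

lemma compact_subset_Jj_closure: "compact_ops w p \<subseteq> Jj_closure w p"
proof
  fix T assume T: "T \<in> compact_ops w p"
  then have TL: "T \<in> L" by (simp add: compact_ops_def)
  obtain C where C: "C > 0" "\<And>x. x \<in> d \<Longrightarrow> nm (T x) \<le> C * nm x" by (rule Lop_bound[OF TL]) blast
  define P where "P N x = (\<lambda>i. if i < N then T x i else 0)" for N x
  define tl where "tl N y = (\<lambda>i. if i < N then 0 else y i)" for N :: nat and y :: rseq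
  have PLlp: "P N \<in> Lop_lp w p" for N
  proof (rule LlpI[of _ "(real N * C powr p) powr (1 / p)"])
    fix x assume x: "x \<in> d"
    have "(\<Sum>n<M. \<bar>P N x n\<bar> powr p) \<le> real N * nm (T x) powr p" for M
    proof -
      have "(\<Sum>n<M. \<bar>P N x n\<bar> powr p) = (\<Sum>n\<in>{..<M} \<inter> {..<N}. \<bar>T x n\<bar> powr p)"
        by (rule sum.mono_neutral_cong_right) (auto simp: P_def)
      also have "\<dots> \<le> (\<Sum>n\<in>{..<M} \<inter> {..<N}. nm (T x) powr p)"
        using coord_le_nm[OF Lop_mem[OF TL x]] p by (intro sum_mono powr_mono2) auto
      also have "\<dots> \<le> real N * nm (T x) powr p"
        using card_mono[of "{..<N}" "{..<M} \<inter> {..<N}"] by (simp add: mult_right_mono)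
      finally show ?thesis .
    qed
    moreover have "nm (T x) powr p \<le> (C * nm x) powr p"
      using C(2)[OF x] p nm_nonneg by (intro powr_mono2) auto
    ultimately have "(\<Sum>n<M. \<bar>P N x n\<bar> powr p) \<le> real N * (C * nm x) powr p" for M
      by (meson mult_left_mono of_nat_0_le_iff order_trans)
    moreover have "real N * (C * nm x) powr p = ((real N * C powr p) powr (1 / p) * nm x) powr p"
      using C(1) nm_nonneg p by (simp add: powr_mult powr_powr)
    ultimately have *: "(\<Sum>n<M. \<bar>P N x n\<bar> powr p) \<le> ((real N * C powr p) powr (1 / p) * nm x) powr p" for M
      by simp
    then show "P N x \<in> lp" by (rule lp_memI)
    show "lpn (P N x) \<le> (real N * C powr p) powr (1 / p) * nm x"
      using * by (rule lp_norm_leI) (auto simp: nm_nonneg)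
  qed (auto simp: P_def fun_eq_iff Lop_add[OF TL] Lop_scale[OF TL] Lop_outside[OF TL])
  \<comment> \<open>The identity operator of the Lorentz space, normalised to vanish elsewhere; it
    is the left factor that exhibits \<open>P N\<close> as a member of
    \<open>Jj w p\<close>.\<close>
  define I where "I = (\<lambda>x. if x \<in> d then x else (\<lambda>n. 0))"
  have "I \<in> L" by (rule LopI[of _ 1]) (auto simp: I_def d_add d_scale)
  moreover have "I \<circ> P N = P N" for N
    using lp_subset_d[OF Llp_mem[OF PLlp]] by (simp add: I_def fun_eq_iff)
  ultimately have PJ: "P N \<in> Jj w p" for N unfolding Jj_iff using PLlp by metis
  have diff: "(\<lambda>n. T x n - P N x n) = tl N (T x)" for N x by (auto simp: P_def tl_def)
  have tld: "tl N y \<in> d" if "y \<in> d" for N y by (rule d_abs_mono[OF that]) (auto simp: tl_def)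
  have tlle: "nm (tl N y) \<le> nm y" if "y \<in> d" for N y by (rule nm_abs_mono[OF that]) (auto simp: tl_def)
  show "T \<in> Jj_closure w p"
    unfolding Jj_closure_iff
  proof (intro conjI allI impI TL, rule ccontr)
    fix e :: real assume e: "e > 0" and no: "\<not> (\<exists>S\<in>Jj w p. near e T S)"
    have "\<exists>x\<in>d. nm x \<le> 1 \<and> e < nm (tl N (T x))" for N
    proof -
      have "\<not> near e T (P N)" using no PJ by blast
      then obtain x where x: "x \<in> d" "e * nm x < nm (tl N (T x))"
        unfolding near_def diff by (auto simp: not_le)
      have "nm x \<noteq> 0"
      proof
        assume "nm x = 0"
        then have "T x = (\<lambda>n. 0)" using nm_eq_0[OF x(1)] Lop_zero[OF TL] by simp
        then show False using x(2) \<open>nm x = 0\<close> nm_zero by (simp add: tl_def)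
      qed
      then have pos: "nm x > 0" using nm_nonneg[of x] by simp
      let ?y = "\<lambda>n. inverse (nm x) * x n"
      have y: "?y \<in> d" "nm ?y = 1" using d_scale[OF x(1)] nm_scale[OF x(1)] pos by auto
      have "tl N (T ?y) = (\<lambda>n. inverse (nm x) * tl N (T x) n)"
        using Lop_scale[OF TL x(1)] by (auto simp: tl_def)
      then have "nm (tl N (T ?y)) = inverse (nm x) * nm (tl N (T x))"
        using nm_scale[OF tld[OF Lop_mem[OF TL x(1)]]] pos by simp
      moreover have "e < inverse (nm x) * nm (tl N (T x))" using x(2) pos by (simp add: field_simps)
      ultimately have "e < nm (tl N (T ?y))" by simp
      then show ?thesis using y by force
    qed
    then obtain x where x: "\<And>N. x N \<in> d" "\<And>N. nm (x N) \<le> 1" "\<And>N. e < nm (tl N (T (x N)))" by metis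
    then obtain r y where r: "strict_mono (r :: nat \<Rightarrow> nat)" and y: "y \<in> d"
      and lim: "(\<lambda>k. nm (\<lambda>n. T (x (r k)) n - y n)) \<longlonglongrightarrow> 0"
      using T unfolding compact_ops_def by blast
    obtain M0 where M0: "\<And>M. M \<ge> M0 \<Longrightarrow> nm (tl M y) \<le> e / 2"
      using tail_small[OF y, of "e / 2"] e unfolding tl_def by auto
    obtain K where K: "\<And>k. k \<ge> K \<Longrightarrow> nm (\<lambda>n. T (x (r k)) n - y n) < e / 2"
      using LIMSEQ_D[OF lim, of "e / 2"] e nm_nonneg by auto
    let ?k = "max M0 K"
    \<comment> \<open>The vector chosen at stage N is tested on its tail beyond N, so the truncation
      level \<open>r ?k\<close> must itself pass \<open>M0\<close> for the tail of \<open>y\<close>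
      to be small.\<close>
    have rk: "M0 \<le> r ?k" using seq_suble[OF r, of ?k] by simp
    have Tx: "T (x (r ?k)) \<in> d" using Lop_mem[OF TL x(1)] .
    have "tl (r ?k) (T (x (r ?k))) = (\<lambda>n. tl (r ?k) (\<lambda>n. T (x (r ?k)) n - y n) n + tl (r ?k) y n)"
      by (auto simp: tl_def)
    then have "nm (tl (r ?k) (T (x (r ?k)))) \<le> nm (tl (r ?k) (\<lambda>n. T (x (r ?k)) n - y n)) + nm (tl (r ?k) y)"
      using nm_triangle[OF tld[OF d_diff[OF Tx y]] tld[OF y], of "r ?k" "r ?k"] by simp
    also have "\<dots> \<le> nm (\<lambda>n. T (x (r ?k)) n - y n) + e / 2"
      using tlle[OF d_diff[OF Tx y]] M0[OF rk] by (intro add_mono)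
    also have "\<dots> < e" using K[of ?k] by simp
    finally show False using x(3)[of "r ?k"] by simp
  qed
qed

end

subsection \<open>Gliding humps\<close>

text \<open>Diagonal extraction for pointwise bounded functions on a countable set, here the set of
  all coordinates.\<close>

lemma coordinatewise_subseq:
  fixes x :: "nat \<Rightarrow> rseq"
  assumes "\<And>n i. \<bar>x n i\<bar> \<le> M"
  obtains r y where "strict_mono (r :: nat \<Rightarrow> nat)" "\<And>i. (\<lambda>n. x (r n) i) \<longlonglongrightarrow> y i"
proof -
  have "norm (x n i) \<le> M" for n i using assms by simp
  then obtain r where "strict_mono (r :: nat \<Rightarrow> nat)" "\<And>i. i \<in> UNIV \<Longrightarrow> \<exists>l. (\<lambda>n. x (r n) i) \<longlonglongrightarrow> l"
    by (rule function_convergent_subsequence[of UNIV x M, rotated]) auto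
  then have "strict_mono r" "\<And>i. \<exists>l. (\<lambda>n. x (r n) i) \<longlonglongrightarrow> l" by auto
  then show ?thesis using that by metis
qed

text \<open>Read \<open>Q k n M M'\<close> as: the n-th vector is good enough for stage
  \<open>k\<close> on the window from \<open>M\<close> up to, but excluding, \<open>M'\<close>. The
  dependent choice runs over triples so that each window starts where the previous one ends and the
  vector indices increase.\<close>

lemma gliding_windows:
  fixes Q :: "nat \<Rightarrow> nat \<Rightarrow> nat \<Rightarrow> nat \<Rightarrow> bool"
  assumes "\<And>k M n0. \<exists>n\<ge>n0. \<exists>M'>M. Q k n M M'"
  obtains r M where "strict_mono r" "strict_mono M" "\<And>k. Q k (r k) (M k) (M (Suc k))"
proof -
  have "\<exists>f. \<forall>k. (case f k of (n, M, M') \<Rightarrow> Q k n M M' \<and> M < M') \<and>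
      (case f k of (n, M, M') \<Rightarrow> case f (Suc k) of (m, N, N') \<Rightarrow> n < m \<and> N = M')"
  proof (rule dependent_nat_choice)
    show "\<exists>x. case x of (n, M, M') \<Rightarrow> Q 0 n M M' \<and> M < M'" using assms[of 0 0 0] by auto
    fix x :: "nat \<times> nat \<times> nat" and k
    obtain n M M' where x: "x = (n, M, M')" by (cases x)
    have "\<exists>n'\<ge>Suc n. \<exists>M''>M'. Q (Suc k) n' M' M''" by (rule assms)
    then show "\<exists>y. (case y of (n, M, M') \<Rightarrow> Q (Suc k) n M M' \<and> M < M') \<and>
        (case x of (n, M, M') \<Rightarrow> case y of (m, N, N') \<Rightarrow> n < m \<and> N = M')"
      unfolding x by (auto simp: Suc_le_eq)
  qed
  then obtain f where f: "\<And>k. (case f k of (n, M, M') \<Rightarrow> Q k n M M' \<and> M < M') \<and>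
      (case f k of (n, M, M') \<Rightarrow> case f (Suc k) of (m, N, N') \<Rightarrow> n < m \<and> N = M')" by blast
  define r where "r k = fst (f k)" for k
  define M where "M k = fst (snd (f k))" for k
  have "Q k (r k) (M k) (M (Suc k)) \<and> M k < M (Suc k) \<and> r k < r (Suc k)" for k
    using f[of k] by (auto simp: r_def M_def split: prod.splits)
  then show ?thesis using that[of r M] by (simp add: strict_mono_Suc_iff)
qed

lemma windows_disjoint:
  fixes M :: "nat \<Rightarrow> nat"
  assumes "strict_mono M" "M j \<le> i" "i < M (Suc j)" "M k \<le> i" "i < M (Suc k)"
  shows "j = k"
  using assms strict_mono_less_eq[OF assms(1)] 
  by (metis le_trans linorder_neqE_nat not_less_eq_eq order_le_less_trans not_le Suc_leI)

text \<open>Serves both as the unit vector of lp and as its image in the Lorentz space.\<close>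

definition unitv :: "nat \<Rightarrow> rseq" where
  "unitv j = (\<lambda>i. if i = j then 1 else 0)"

text \<open>The error made when \<open>x\<close> is replaced by its restriction to the
  window.\<close>

definition off :: "nat \<Rightarrow> nat \<Rightarrow> rseq \<Rightarrow> rseq" where
  "off M M' x = (\<lambda>i. if M \<le> i \<and> i < M' then 0 else x i)"

context lorentz_weight
begin

lemma unitv_lp: "unitv j \<in> lp"
proof -
  have "(\<lambda>n. \<bar>unitv j n\<bar> powr p) = (\<lambda>n. if n = j then 1 else 0)" using p by (auto simp: unitv_def)
  then show ?thesis by (simp add: lp_space_def)
qed

lemma unitv_d: "unitv j \<in> d"
  using lp_subset_d unitv_lp by blast

lemma off_d: "x \<in> d \<Longrightarrow> off M M' x \<in> d"
  by (rule d_abs_mono[of x]) (auto simp: off_def)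

text \<open>Left of the window there are finitely many coordinates, each tending to 0 along the
  sequence; on the right the tail of one fixed vector is small. Hence the order of choice:
  \<open>n\<close> depends on \<open>M\<close>, and the right end depends on
  \<open>n\<close>.\<close>

lemma off_small:
  assumes d: "\<And>n. y n \<in> d" and null: "\<And>i. (\<lambda>n. y n i) \<longlonglongrightarrow> 0" and e: "e > 0"
  shows "\<exists>n1. \<forall>n\<ge>n1. \<exists>M1. \<forall>M'\<ge>M1. nm (off M M' (y n)) \<le> e"
proof -
  \<comment> \<open>As weights are at most 1, \<open>M\<close> coordinates of size \<open>c\<close>
    have p-th power of the norm at most \<open>M * c powr p\<close>, which is at most that of (M +
    1) c = e / 2.\<close>
  define c where "c = e / 2 / (real M + 1)"
  have c: "c > 0" using e by (simp add: c_def)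
  have "real M * c powr p \<le> (real M + 1) powr p * c powr p"
  proof (rule mult_right_mono)
    have "real M \<le> (real M + 1) powr 1" by simp
    also have "\<dots> \<le> (real M + 1) powr p" using p by (intro powr_mono) auto
    finally show "real M \<le> (real M + 1) powr p" .
  qed simp
  also have "\<dots> = ((real M + 1) * c) powr p" using c by (simp add: powr_mult)
  also have "(real M + 1) * c = e / 2"
    unfolding c_def by (subst times_divide_eq_right, rule nonzero_mult_div_cancel_left) simp
  finally have ce: "real M * c powr p \<le> (e / 2) powr p" .
  have "eventually (\<lambda>n. \<forall>i\<in>{..<M}. \<bar>y n i\<bar> < c) sequentially"
    using order_tendstoD(2)[OF tendsto_rabs_zero[OF null] c] by (intro eventually_ball_finite) auto
  then obtain n1 where n1: "\<And>n i. n \<ge> n1 \<Longrightarrow> i < M \<Longrightarrow> \<bar>y n i\<bar> < c"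
    unfolding eventually_sequentially by auto
  show ?thesis
  proof (rule exI[of _ n1], intro allI impI)
    fix n assume n: "n1 \<le> n"
    obtain M0 where M0: "\<And>M. M \<ge> M0 \<Longrightarrow> nm (\<lambda>i. if i < M then 0 else y n i) \<le> e / 2"
      using tail_small[OF d, of "e / 2" n] e by auto
    show "\<exists>M1. \<forall>M'\<ge>M1. nm (off M M' (y n)) \<le> e"
    proof (intro exI[of _ "max M M0"] allI impI)
      fix M' assume M': "max M M0 \<le> M'"
      let ?h = "\<lambda>i. if i < M then y n i else 0" and ?t = "\<lambda>i. if i < M' then 0 else y n i"
      have hd: "?h \<in> d" "?t \<in> d" by (rule d_abs_mono[OF d[of n]]; simp)+
      have "wbound (\<lambda>i. if i < M then ?h i else 0) (real M * c powr p)"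
        using n1[OF n] c by (intro wbound_initial) (auto intro: less_imp_le)
      then have "nm ?h powr p \<le> (e / 2) powr p"
        using nm_powr_le ce by (fastforce cong: if_cong)
      then have "nm ?h \<le> e / 2" using powr_p_le_iff nm_nonneg e by simp
      moreover have "off M M' (y n) = (\<lambda>i. ?h i + ?t i)" using M' by (auto simp: off_def)
      ultimately show "nm (off M M' (y n)) \<le> e"
        using nm_triangle[OF hd] M0[of M'] M' by simp
    qed
  qed
qed

text \<open>Both the vectors and their images converge coordinatewise along a subsequence, but the
  limit \<open>y\<close> of the images need not be the image of the limit \<open>x\<close>.
  Differences of two far members are null on both sides whatever the relation between
  \<open>x\<close> and \<open>y\<close>.\<close>

lemma noncompact_null_sequence:
  assumes T: "T \<in> L" "T \<notin> compact_ops w p"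
  obtains v B \<delta> where "\<And>n. v n \<in> d" "\<And>n. nm (v n) \<le> B" "\<And>i. (\<lambda>n. v n i) \<longlonglongrightarrow> 0"
    "\<And>i. (\<lambda>n. T (v n) i) \<longlonglongrightarrow> 0" "\<delta> > 0" "\<And>n. \<delta> \<le> nm (T (v n))"
proof -
  obtain xs M where xs: "\<And>k. xs k \<in> d" "\<And>k. nm (xs k) \<le> M"
    and nc: "\<And>r y. strict_mono (r::nat\<Rightarrow>nat) \<Longrightarrow> y \<in> d \<Longrightarrow> \<not> (\<lambda>k. nm (\<lambda>n. T (xs (r k)) n - y n)) \<longlonglongrightarrow> 0"
    using T unfolding compact_ops_def by blast
  obtain C where C: "C > 0" "\<And>x. x \<in> d \<Longrightarrow> nm (T x) \<le> C * nm x" by (rule Lop_bound[OF T(1)]) blast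
  have Txs: "T (xs k) \<in> d" "nm (T (xs k)) \<le> C * M" for k
    using Lop_mem[OF T(1) xs(1)] order_trans[OF C(2)[OF xs(1)] mult_left_mono[OF xs(2)]] C(1) by auto
  have "\<bar>xs n i\<bar> \<le> M" for n i using order_trans[OF coord_le_nm[OF xs(1)] xs(2)] .
  then obtain r1 x where r1: "strict_mono r1" "\<And>i. (\<lambda>n. xs (r1 n) i) \<longlonglongrightarrow> x i"
    using coordinatewise_subseq[of xs M] by blast
  have "\<bar>T (xs (r1 n)) i\<bar> \<le> C * M" for n i using order_trans[OF coord_le_nm[OF Txs(1)] Txs(2)] .
  then obtain r2 y where r2: "strict_mono r2" "\<And>i. (\<lambda>n. T (xs (r1 (r2 n))) i) \<longlonglongrightarrow> y i"
    using coordinatewise_subseq[of "\<lambda>n. T (xs (r1 n))" "C * M"] by blast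
  define x' where "x' n = xs (r1 (r2 n))" for n
  define z where "z n = T (x' n)" for n
  have x'd: "x' n \<in> d" "nm (x' n) \<le> M" for n using xs by (auto simp: x'_def)
  have zd: "z n \<in> d" "nm (z n) \<le> C * M" for n using Txs by (auto simp: x'_def z_def)
  have x'lim: "(\<lambda>n. x' n i) \<longlonglongrightarrow> x i" for i
    using LIMSEQ_subseq_LIMSEQ[OF r1(2) r2(1)] by (simp add: x'_def comp_def)
  have zlim: "(\<lambda>n. z n i) \<longlonglongrightarrow> y i" for i using r2(2) by (simp add: x'_def z_def)
  have yd: "y \<in> d" by (rule fatou(1)[OF zd zlim])
  have "\<not> (\<lambda>n. nm (\<lambda>i. z n i - y i)) \<longlonglongrightarrow> 0"
    using nc[OF strict_mono_o[OF r1(1) r2(1)] yd] by (simp add: z_def x'_def)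
  then obtain \<delta> where \<delta>: "\<delta> > 0" "\<And>N. \<exists>n\<ge>N. \<delta> \<le> nm (\<lambda>i. z n i - y i)"
    by (auto simp: LIMSEQ_iff not_less nm_nonneg)
  have "\<exists>n m. n \<ge> N \<and> m \<ge> N \<and> \<delta> / 2 \<le> nm (\<lambda>i. z n i - z m i)" for N
  proof -
    obtain n where n: "n \<ge> N" "\<delta> \<le> nm (\<lambda>i. z n i - y i)" using \<delta>(2) by blast
    \<comment> \<open>If all later members were within \<delta>/2 of \<open>z n\<close>, lower
      semicontinuity would put \<open>y\<close> within \<delta>/2 of it as well.\<close>
    have "\<exists>m. \<delta> / 2 \<le> nm (\<lambda>i. z n i - z (m + n) i)"
    proof (rule ccontr)
      assume "\<not> ?thesis"
      then have "nm (\<lambda>i. z n i - z (m + n) i) \<le> \<delta> / 2" for m by (meson less_imp_le not_le)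
      moreover have "(\<lambda>m. z n i - z (m + n) i) \<longlonglongrightarrow> z n i - y i" for i
        by (intro tendsto_diff tendsto_const LIMSEQ_ignore_initial_segment zlim)
      ultimately have "nm (\<lambda>i. z n i - y i) \<le> \<delta> / 2"
        by (rule fatou(2)[OF d_diff[OF zd(1) zd(1)]])
      then show False using n \<delta>(1) by simp
    qed
    then obtain m where "\<delta> / 2 \<le> nm (\<lambda>i. z n i - z (m + n) i)" by blast
    then show ?thesis using n(1) by (intro exI[of _ n] exI[of _ "m + n"]) simp
  qed
  then obtain a b where ab: "\<And>N. a N \<ge> N" "\<And>N. b N \<ge> N" "\<And>N. \<delta> / 2 \<le> nm (\<lambda>i. z (a N) i - z (b N) i)"
    by metis
  have lim: "filterlim a sequentially sequentially" "filterlim b sequentially sequentially"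
    using ab by (auto intro!: filterlim_at_top_mono[OF filterlim_ident] simp: eventually_sequentially)
  define v where "v N = (\<lambda>i. x' (a N) i - x' (b N) i)" for N
  have Tv: "T (v N) = (\<lambda>i. z (a N) i - z (b N) i)" for N
    unfolding v_def z_def by (rule Lop_diff[OF T(1) x'd(1) x'd(1)])
  show ?thesis
  proof (rule that[of v "M + M" "\<delta> / 2"])
    show "v n \<in> d" for n unfolding v_def by (intro d_diff x'd)
    show "nm (v n) \<le> M + M" for n
      unfolding v_def using nm_triangle_diff[OF x'd(1) x'd(1)] x'd(2) by (meson add_mono order_trans)
    show "(\<lambda>n. v n i) \<longlonglongrightarrow> 0" for i
      using tendsto_diff[OF filterlim_compose[OF x'lim lim(1)] filterlim_compose[OF x'lim lim(2)], of i i]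
      by (simp add: v_def)
    show "(\<lambda>n. T (v n) i) \<longlonglongrightarrow> 0" for i
      using tendsto_diff[OF filterlim_compose[OF zlim lim(1)] filterlim_compose[OF zlim lim(2)], of i i]
      by (simp add: Tv)
    show "\<delta> / 2 \<le> nm (T (v n))" for n using ab(3) by (simp add: Tv)
  qed (use \<delta> in simp)
qed

lemma noncompact_blocks:
  assumes T: "T \<in> L" "T \<notin> compact_ops w p"
  obtains u B \<delta> where "\<And>n. u n \<in> d" "\<And>n. nm (u n) \<le> B" "\<And>i j k. u j i \<noteq> 0 \<Longrightarrow> u k i \<noteq> 0 \<Longrightarrow> j = k"
    "\<And>i. (\<lambda>n. T (u n) i) \<longlonglongrightarrow> 0" "\<delta> > 0" "\<And>n. \<delta> \<le> nm (T (u n))"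
proof -
  obtain v B \<delta> where v: "\<And>n. v n \<in> d" "\<And>n. nm (v n) \<le> B" "\<And>i. (\<lambda>n. v n i) \<longlonglongrightarrow> 0"
    "\<And>i. (\<lambda>n. T (v n) i) \<longlonglongrightarrow> 0" "\<delta> > 0" "\<And>n. \<delta> \<le> nm (T (v n))"
    by (rule noncompact_null_sequence[OF T]) blast
  obtain C where C: "C > 0" "\<And>x. x \<in> d \<Longrightarrow> nm (T x) \<le> C * nm x" by (rule Lop_bound[OF T(1)]) blast
  \<comment> \<open>The image of the k-th cutting error then has norm at most \<delta>/(2(k+1)):
    never more than \<delta>/2, which preserves a lower bound, and tending to 0, which preserves
    coordinatewise nullity.\<close>
  define \<eta> where "\<eta> k = \<delta> / 2 / C / real (Suc k)" for k
  have \<eta>: "\<eta> k > 0" for k using v(5) C(1) by (simp add: \<eta>_def)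
  have "\<exists>n\<ge>n0. \<exists>M'>M. nm (off M M' (v n)) \<le> \<eta> k" for k M n0
  proof -
    obtain n1 where "\<And>n. n \<ge> n1 \<Longrightarrow> \<exists>M1. \<forall>M'\<ge>M1. nm (off M M' (v n)) \<le> \<eta> k"
      using off_small[OF v(1,3) \<eta>] by blast
    then obtain M1 where "\<And>M'. M' \<ge> M1 \<Longrightarrow> nm (off M M' (v (max n0 n1))) \<le> \<eta> k"
      by (meson max.cobounded2)
    then show ?thesis
      by (intro exI[of _ "max n0 n1"] conjI exI[of _ "max M1 (Suc M)"]) auto
  qed
  then obtain r M where rM: "strict_mono r" "strict_mono M"
    "\<And>k. nm (off (M k) (M (Suc k)) (v (r k))) \<le> \<eta> k"
    by (rule gliding_windows[where Q = "\<lambda>k n M M'. nm (off M M' (v n)) \<le> \<eta> k"]) blast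
  define u where "u k i = (if M k \<le> i \<and> i < M (Suc k) then v (r k) i else 0)" for k i
  define s where "s k = off (M k) (M (Suc k)) (v (r k))" for k
  have sd: "s k \<in> d" for k unfolding s_def by (rule off_d[OF v(1)])
  have u: "u k = (\<lambda>i. v (r k) i - s k i)" for k by (auto simp: u_def s_def off_def)
  have Tu: "T (u k) = (\<lambda>i. T (v (r k)) i - T (s k) i)" for k
    unfolding u by (rule Lop_diff[OF T(1) v(1) sd])
  have Ts: "nm (T (s k)) \<le> \<delta> / 2 / real (Suc k)" for k
  proof -
    have "nm (T (s k)) \<le> C * \<eta> k"
      using order_trans[OF C(2)[OF sd] mult_left_mono[OF rM(3)[folded s_def]]] C(1) by simp
    then show ?thesis using C(1) by (simp add: \<eta>_def)
  qed
  show ?thesis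
  proof (rule that[of u B "\<delta> / 2"])
    show ud: "u n \<in> d" for n unfolding u by (intro d_diff v sd)
    show "nm (u n) \<le> B" for n
      by (rule order_trans[OF nm_abs_mono v(2)[of "r n"]]) (auto simp: u_def v)
    show "j = k" if "u j i \<noteq> 0" "u k i \<noteq> 0" for i j k
      using that windows_disjoint[OF rM(2), of j i k] by (auto simp: u_def split: if_splits)
    show "(\<lambda>n. T (u n) i) \<longlonglongrightarrow> 0" for i
    proof -
      have 1: "(\<lambda>n. T (v (r n)) i) \<longlonglongrightarrow> 0" using LIMSEQ_subseq_LIMSEQ[OF v(4) rM(1)] by (simp add: comp_def)
      have 2: "(\<lambda>n. T (s n) i) \<longlonglongrightarrow> 0"
      proof (rule Lim_null_comparison)
        show "\<forall>\<^sub>F n in sequentially. norm (T (s n) i) \<le> \<delta> / 2 / real (Suc n)"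
          using order_trans[OF coord_le_nm[OF Lop_mem[OF T(1) sd]] Ts] by simp
        show "(\<lambda>n. \<delta> / 2 / real (Suc n)) \<longlonglongrightarrow> 0"
          using LIMSEQ_Suc[OF lim_const_over_n[of "\<delta> / 2"]] by simp
      qed
      show ?thesis using tendsto_diff[OF 1 2] by (simp add: Tu)
    qed
    show "\<delta> / 2 \<le> nm (T (u n))" for n
    proof -
      have "\<delta> \<le> nm (T (v (r n)))" by (rule v)
      also have "T (v (r n)) = (\<lambda>i. T (u n) i + T (s n) i)" by (simp add: Tu)
      also have "nm \<dots> \<le> nm (T (u n)) + nm (T (s n))"
        by (intro nm_triangle Lop_mem[OF T(1)] ud sd)
      also have "nm (T (s n)) \<le> \<delta> / 2"
        using order_trans[OF Ts[of n], of "\<delta> / 2"] v(5) by (simp add: divide_le_eq)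
      finally show ?thesis by simp
    qed
  qed (use v in simp)
qed

subsection \<open>Mapping seminormalised null sequences to the unit vectors\<close>

text \<open>One coordinate \<open>m k\<close> of modulus at least \<open>\<theta>\<close> is read in
  each window and divided by its value. Selecting distinct coordinates does not increase the norm,
  so \<open>C\<close> is bounded by 1/\<theta>.\<close>

lemma select_large_coordinates:
  assumes y: "\<And>n. y n \<in> d" "\<And>i. (\<lambda>n. y n i) \<longlonglongrightarrow> 0" and \<theta>: "\<theta> > 0"
    and large: "\<And>N. \<exists>n\<ge>N. \<exists>m. \<theta> \<le> \<bar>y n m\<bar>" and \<epsilon>: "\<And>j. \<epsilon> j > 0"
  obtains r C where "strict_mono (r :: nat \<Rightarrow> nat)" "C \<in> L" "\<And>j. nm (\<lambda>i. C (y (r j)) i - unitv j i) \<le> \<epsilon> j"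
proof -
  define Q where "Q k n M M' \<longleftrightarrow> nm (off M M' (y n)) \<le> \<theta> * \<epsilon> k \<and> (\<exists>m\<ge>M. m < M' \<and> \<theta> \<le> \<bar>y n m\<bar>)" for k n M M'
  have "\<exists>n\<ge>n0. \<exists>M'>M. Q k n M M'" for k M n0
  proof -
    have "\<theta> * \<epsilon> k > 0" using \<theta> \<epsilon> by simp
    then obtain n1 where n1: "\<And>n. n \<ge> n1 \<Longrightarrow> \<exists>M1. \<forall>M'\<ge>M1. nm (off M M' (y n)) \<le> \<theta> * \<epsilon> k"
      using off_small[OF y] by blast
    have "eventually (\<lambda>n. \<forall>i\<in>{..<M}. \<bar>y n i\<bar> < \<theta>) sequentially"
      using order_tendstoD(2)[OF tendsto_rabs_zero[OF y(2)] \<theta>] by (intro eventually_ball_finite) auto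
    then obtain n2 where n2: "\<And>n i. n \<ge> n2 \<Longrightarrow> i < M \<Longrightarrow> \<bar>y n i\<bar> < \<theta>"
      unfolding eventually_sequentially by auto
    obtain n m where n: "n \<ge> max n0 (max n1 n2)" "\<theta> \<le> \<bar>y n m\<bar>" using large by blast
    \<comment> \<open>Before \<open>M\<close> all entries of this vector are already smaller than
      \<open>\<theta>\<close>, so its large coordinate lies to the right.\<close>
    then have m: "M \<le> m" using n2[of n m] by force
    obtain M1 where M1: "\<And>M'. M' \<ge> M1 \<Longrightarrow> nm (off M M' (y n)) \<le> \<theta> * \<epsilon> k" using n1[of n] n(1) by auto
    have "Q k n M (max M1 (Suc m))" unfolding Q_def using M1 m n(2) by (auto intro!: exI[of _ m])
    then show ?thesis using n(1) m by (intro exI[of _ n] conjI exI[of _ "max M1 (Suc m)"]) auto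
  qed
  then obtain r M where rM: "strict_mono r" "strict_mono M" "\<And>k. Q k (r k) (M k) (M (Suc k))"
    by (rule gliding_windows[where Q = Q]) blast
  then obtain m where m: "\<And>k. M k \<le> m k" "\<And>k. m k < M (Suc k)" "\<And>k. \<theta> \<le> \<bar>y (r k) (m k)\<bar>"
    unfolding Q_def by metis
  have inj: "inj m" using windows_disjoint[OF rM(2)] m by (metis injI)
  define C where "C z = (if z \<in> d then \<lambda>k. z (m k) / y (r k) (m k) else (\<lambda>k. 0))" for z
  have Cb: "C z \<in> d" "nm (C z) \<le> inverse \<theta> * nm z" if z: "z \<in> d" for z
  proof -
    have g: "(\<lambda>n. inverse \<theta> * z (m n)) \<in> d" by (rule d_scale[OF d_subseq[OF z inj]])
    have le: "\<bar>C z k\<bar> \<le> \<bar>inverse \<theta> * z (m k)\<bar>" for k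
    proof -
      have "\<bar>C z k\<bar> = \<bar>z (m k)\<bar> / \<bar>y (r k) (m k)\<bar>" using z by (simp add: C_def)
      also have "\<dots> \<le> \<bar>z (m k)\<bar> / \<theta>" using m(3)[of k] \<theta> by (intro divide_left_mono mult_pos_pos) auto
      finally show ?thesis using \<theta> by (simp add: abs_mult field_simps)
    qed
    show "C z \<in> d" by (rule d_abs_mono[OF g le])
    have "nm (C z) \<le> nm (\<lambda>n. inverse \<theta> * z (m n))" by (rule nm_abs_mono[OF g le])
    also have "\<dots> = inverse \<theta> * nm (\<lambda>n. z (m n))" using nm_scale[OF d_subseq[OF z inj]] \<theta> by simp
    also have "\<dots> \<le> inverse \<theta> * nm z" using nm_subseq[OF z inj] \<theta> by (intro mult_left_mono) auto
    finally show "nm (C z) \<le> inverse \<theta> * nm z" .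
  qed
  have CL: "C \<in> L"
    by (rule LopI[of _ "inverse \<theta>"]) (use Cb in \<open>auto simp: C_def d_add d_scale add_divide_distrib\<close>)
  have "nm (\<lambda>i. C (y (r j)) i - unitv j i) \<le> \<epsilon> j" for j
  proof -
    let ?s = "off (M j) (M (Suc j)) (y (r j))"
    have s: "?s \<in> d" by (rule off_d[OF y(1)])
    \<comment> \<open>\<open>C\<close> sends the hump exactly to the unit vector, so the whole error
      comes from outside the window.\<close>
    have "(\<lambda>i. C (y (r j)) i - unitv j i) = C ?s"
    proof
      fix k
      have "y (r k) (m k) \<noteq> 0" using m(3)[of k] \<theta> by auto
      then show "C (y (r j)) k - unitv j k = C ?s k"
        using s y(1) m windows_disjoint[OF rM(2), of k "m k" j] by (auto simp: C_def off_def unitv_def)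
    qed
    then have "nm (\<lambda>i. C (y (r j)) i - unitv j i) \<le> inverse \<theta> * nm ?s" using Cb(2)[OF s] by simp
    also have "\<dots> \<le> inverse \<theta> * (\<theta> * \<epsilon> j)" using rM(3)[of j] \<theta> by (intro mult_left_mono) (auto simp: Q_def)
    also have "\<dots> = \<epsilon> j" using \<theta> by simp
    finally show ?thesis .
  qed
  then show ?thesis using that[OF rM(1) CL] by blast
qed

text \<open>Small coordinates carry little weight under the first \<open>M\<close> indices of \<open>w\<close>, so the weights norming
  successive vectors can be taken from disjoint ranges.\<close>

lemma map_flat_sequence:
  assumes y: "\<And>n. y n \<in> d" "\<And>i. (\<lambda>n. y n i) \<longlonglongrightarrow> 0" and \<delta>: "\<delta> > 0" "\<And>n. \<delta> \<le> nm (y n)"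
    and flat: "\<And>\<theta>. \<theta> > 0 \<Longrightarrow> \<exists>N. \<forall>n\<ge>N. \<forall>i. \<bar>y n i\<bar> < \<theta>" and \<epsilon>: "\<And>j. \<epsilon> j > 0"
  obtains r B where "strict_mono (r :: nat \<Rightarrow> nat)" "B \<in> Lop_lp w p"
    "\<And>j. lpn (\<lambda>i. B (y (r j)) i - unitv j i) \<le> \<epsilon> j"
proof -
  define c where "c = \<delta> powr p"
  have c: "c > 0" using \<delta> by (simp add: c_def)
  \<comment> \<open>The bound of the operator to be built: each norming sum will be at least c/2,
    and averaging against it costs the factor 2/c in p-th powers.\<close>
  define K where "K = (2 / c) powr (1 / p)"
  have K: "K > 0" "K powr p = 2 / c" using c p by (auto simp: K_def powr_powr)
  define Q where "Q k n M M' \<longleftrightarrow> nm (off M M' (y n)) \<le> \<epsilon> k / K \<and>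
    (\<exists>I \<sigma>. finite I \<and> I \<subseteq> {M..<M'} \<and> inj_on \<sigma> I \<and> \<sigma> ` I \<subseteq> {M..<M'} \<and>
       c / 2 \<le> (\<Sum>i\<in>I. w (\<sigma> i) * \<bar>y n i\<bar> powr p))" for k n M M'
  have "\<exists>n\<ge>n0. \<exists>M'>M. Q k n M M'" for k M n0
  proof -
    have "\<epsilon> k / K > 0" using K \<epsilon> by simp
    then obtain n1 where n1: "\<And>n. n \<ge> n1 \<Longrightarrow> \<exists>M1. \<forall>M'\<ge>M1. nm (off M M' (y n)) \<le> \<epsilon> k / K"
      using off_small[OF y] by blast
    \<comment> \<open>At most 2M indices are discarded below, M for their position and M for their
      weight index. Terms of size at most \<open>\<theta> powr p\<close> lose at most c/4 in total,
      so a sum above 3c/4 keeps c/2.\<close>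
    define \<theta> where "\<theta> = (c / 4 / (2 * real M + 1)) powr (1 / p)"
    have \<theta>: "\<theta> > 0" "\<theta> powr p = c / 4 / (2 * real M + 1)" using c p by (auto simp: \<theta>_def powr_powr)
    then obtain n2 where n2: "\<And>n i. n \<ge> n2 \<Longrightarrow> \<bar>y n i\<bar> < \<theta>" using flat by blast
    define n where "n = max n0 (max n1 n2)"
    have "\<not> wbound (y n) (3 / 4 * c)"
    proof
      assume "wbound (y n) (3 / 4 * c)"
      then have "nm (y n) powr p \<le> 3 / 4 * c" by (rule nm_powr_le)
      moreover have "c \<le> nm (y n) powr p" unfolding c_def using \<delta> p by (intro powr_mono2) auto
      ultimately show False using c by simp
    qed
    then obtain I0 \<sigma> where I0: "finite I0" "inj_on \<sigma> I0" "3 / 4 * c < (\<Sum>i\<in>I0. w (\<sigma> i) * \<bar>y n i\<bar> powr p)"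
      unfolding wbound_def by (auto simp: not_le)
    define I where "I = {i \<in> I0. M \<le> i \<and> M \<le> \<sigma> i}"
    have I: "finite I" "I \<subseteq> I0" "inj_on \<sigma> I" using I0 by (auto simp: I_def inj_on_def)
    have "(\<Sum>i\<in>I0 - I. w (\<sigma> i) * \<bar>y n i\<bar> powr p) \<le> (\<Sum>i\<in>I0 - I. 1 * \<theta> powr p)"
    proof (intro sum_mono mult_mono powr_mono2)
      show "\<bar>y n i\<bar> \<le> \<theta>" for i using n2[of n i] by (intro less_imp_le) (simp add: n_def)
    qed (use p w_nonneg w_le_1 in auto)
    also have "\<dots> = real (card (I0 - I)) * \<theta> powr p" by simp
    also have "\<dots> \<le> (2 * real M) * \<theta> powr p"
    proof (rule mult_right_mono)
      have "I0 - I \<subseteq> (I0 \<inter> {..<M}) \<union> {i \<in> I0. \<sigma> i < M}" by (auto simp: I_def)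
      then have "card (I0 - I) \<le> card ((I0 \<inter> {..<M}) \<union> {i \<in> I0. \<sigma> i < M})"
        using I0(1) by (intro card_mono) auto
      also have "\<dots> \<le> card (I0 \<inter> {..<M}) + card {i \<in> I0. \<sigma> i < M}" by (rule card_Un_le)
      also have "card (I0 \<inter> {..<M}) \<le> M" using card_mono[of "{..<M}" "I0 \<inter> {..<M}"] by simp
      also have "card {i \<in> I0. \<sigma> i < M} = card (\<sigma> ` {i \<in> I0. \<sigma> i < M})"
        using I0(2) by (intro card_image[symmetric]) (auto simp: inj_on_def)
      also have "\<dots> \<le> card {..<M}" by (intro card_mono) auto
      finally show "real (card (I0 - I)) \<le> 2 * real M" by simp
    qed simp
    also have "\<dots> \<le> c / 4" unfolding \<theta>(2) using c by (simp add: field_simps)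
    finally have "(\<Sum>i\<in>I0 - I. w (\<sigma> i) * \<bar>y n i\<bar> powr p) \<le> c / 4" .
    then have big: "c / 2 \<le> (\<Sum>i\<in>I. w (\<sigma> i) * \<bar>y n i\<bar> powr p)"
      using I0(3) sum.subset_diff[OF I(2) I0(1), of "\<lambda>i. w (\<sigma> i) * \<bar>y n i\<bar> powr p"] by simp
    have "finite (I \<union> \<sigma> ` I)" using I by simp
    then obtain M2 where M2: "I \<union> \<sigma> ` I \<subseteq> {..<M2}" using finite_nat_bounded by blast
    obtain M1 where M1: "\<And>M'. M' \<ge> M1 \<Longrightarrow> nm (off M M' (y n)) \<le> \<epsilon> k / K" using n1[of n] unfolding n_def by (meson max.cobounded1 max.coboundedI2)
    define M' where "M' = max M1 (max M2 (Suc M))"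
    have "I \<subseteq> {M..<M'}" "\<sigma> ` I \<subseteq> {M..<M'}" using M2 by (auto simp: I_def M'_def less_max_iff_disj)
    then have "Q k n M M'" unfolding Q_def using M1[of M'] I big by (auto simp: M'_def)
    moreover have "M < M'" "n0 \<le> n" by (auto simp: M'_def n_def)
    ultimately show ?thesis by blast
  qed
  then obtain r M where rM: "strict_mono r" "strict_mono M" "\<And>k. Q k (r k) (M k) (M (Suc k))"
    by (rule gliding_windows[where Q = Q]) blast
  define R where "R k I \<sigma> \<longleftrightarrow> finite I \<and> I \<subseteq> {M k..<M (Suc k)} \<and> inj_on \<sigma> I \<and> \<sigma> ` I \<subseteq> {M k..<M (Suc k)} \<and>
      c / 2 \<le> (\<Sum>i\<in>I. w (\<sigma> i) * \<bar>y (r k) i\<bar> powr p)" for k I \<sigma>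
  have "\<exists>I \<sigma>. R k I \<sigma>" for k using rM(3)[of k] unfolding Q_def R_def by blast
  then obtain I \<sigma> where "\<And>k. R k (I k) (\<sigma> k)" by metis
  then have I: "\<And>k. finite (I k)" "\<And>k. I k \<subseteq> {M k..<M (Suc k)}" "\<And>k. inj_on (\<sigma> k) (I k)"
    "\<And>k. \<sigma> k ` I k \<subseteq> {M k..<M (Suc k)}" "\<And>k. c / 2 \<le> (\<Sum>i\<in>I k. w (\<sigma> k i) * \<bar>y (r k) i\<bar> powr p)"
    unfolding R_def by auto
  define g where "g k i = w (\<sigma> k i) * \<bar>y (r k) i\<bar> powr p" for k i
  define S where "S k = sum (g k) (I k)" for k
  have g0: "0 \<le> g k i" for k i using w_nonneg by (simp add: g_def)
  have S: "c / 2 \<le> S k" "S k > 0" for k using I(5)[of k] c by (auto simp: S_def g_def)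
  \<comment> \<open>The mean of the ratios of \<open>z\<close> to the k-th vector, weighted by that
    vector's terms in its norming sum. Its value at the vector is therefore 1; indices where the
    vector vanishes have weight 0, so division by zero does no harm.\<close>
  define \<phi> where "\<phi> k z = (\<Sum>i\<in>I k. g k i * (z i / y (r k) i)) / S k" for k and z :: rseq
  have Idisj: "j = k" if "i \<in> I j" "i \<in> I k" for i j k
    using that I(2) by (intro windows_disjoint[OF rM(2), of j i k]) force+
  have \<sigma>disj: "j = k" if "i \<in> \<sigma> j ` I j" "i \<in> \<sigma> k ` I k" for i j k
    using that I(4) by (intro windows_disjoint[OF rM(2), of j i k]) force+
  have \<phi>_le: "\<bar>\<phi> k z\<bar> powr p \<le> 2 / c * (\<Sum>i\<in>I k. w (\<sigma> k i) * \<bar>z i\<bar> powr p)" for k z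
  proof -
    have "\<bar>\<Sum>i\<in>I k. g k i * (z i / y (r k) i)\<bar> powr p
        \<le> S k powr (p - 1) * (\<Sum>i\<in>I k. g k i * \<bar>z i / y (r k) i\<bar> powr p)"
      unfolding S_def using S(2)[of k, unfolded S_def] by (intro weighted_power_mean p I g0)
    also have "\<dots> \<le> S k powr (p - 1) * (\<Sum>i\<in>I k. w (\<sigma> k i) * \<bar>z i\<bar> powr p)"
    proof (intro mult_left_mono sum_mono)
      fix i
      have "\<bar>y (r k) i\<bar> powr p * \<bar>z i / y (r k) i\<bar> powr p \<le> \<bar>z i\<bar> powr p"
        by (cases "y (r k) i = 0") (simp_all add: abs_divide powr_divide)
      then show "g k i * \<bar>z i / y (r k) i\<bar> powr p \<le> w (\<sigma> k i) * \<bar>z i\<bar> powr p"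
        using w_nonneg by (simp add: g_def mult.assoc mult_left_mono)
    qed simp
    finally have "\<bar>\<phi> k z\<bar> powr p \<le> S k powr (p - 1) * (\<Sum>i\<in>I k. w (\<sigma> k i) * \<bar>z i\<bar> powr p) / S k powr p"
      using S(2)[of k] by (simp add: \<phi>_def abs_divide powr_divide divide_right_mono)
    also have "\<dots> = inverse (S k) * (\<Sum>i\<in>I k. w (\<sigma> k i) * \<bar>z i\<bar> powr p)"
      using S(2)[of k] by (simp add: powr_diff field_simps)
    also have "\<dots> \<le> inverse (c / 2) * (\<Sum>i\<in>I k. w (\<sigma> k i) * \<bar>z i\<bar> powr p)"
      using S(1)[of k] c w_nonneg by (intro mult_right_mono le_imp_inverse_le sum_nonneg) auto
    finally show ?thesis by simp
  qed
  have sum_le: "(\<Sum>k<N. \<bar>\<phi> k z\<bar> powr p) \<le> (K * nm z) powr p" if z: "z \<in> d" for N z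
  proof -
    \<comment> \<open>Glues the maps \<open>\<sigma> k\<close> into one assignment on the union of
      the blocks. It is injective because the weight ranges of different blocks are disjoint, so all
      functionals together are controlled by a single sum for \<open>z\<close>.\<close>
    define \<kappa> where "\<kappa> i = (THE k. i \<in> I k)" for i
    have \<kappa>: "\<kappa> i = k" if "i \<in> I k" for i k unfolding \<kappa>_def using that Idisj by blast
    let ?U = "\<Union>k<N. I k"
    have "(\<Sum>k<N. \<bar>\<phi> k z\<bar> powr p) \<le> (\<Sum>k<N. 2 / c * (\<Sum>i\<in>I k. w (\<sigma> k i) * \<bar>z i\<bar> powr p))"
      by (intro sum_mono \<phi>_le)
    also have "\<dots> = 2 / c * (\<Sum>k<N. \<Sum>i\<in>I k. w (\<sigma> (\<kappa> i) i) * \<bar>z i\<bar> powr p)"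
      unfolding sum_distrib_left[symmetric] using \<kappa> by (intro arg_cong2[of _ _ _ _ "(*)"] sum.cong) auto
    also have "(\<Sum>k<N. \<Sum>i\<in>I k. w (\<sigma> (\<kappa> i) i) * \<bar>z i\<bar> powr p) = (\<Sum>i\<in>?U. w (\<sigma> (\<kappa> i) i) * \<bar>z i\<bar> powr p)"
      using I(1) Idisj by (intro sum.UNION_disjoint[symmetric]) auto
    also have "\<dots> \<le> nm z powr p"
    proof (rule wboundD[OF wbound_nm[OF z]])
      show "finite ?U" using I(1) by simp
      show "inj_on (\<lambda>i. \<sigma> (\<kappa> i) i) ?U"
      proof (rule inj_onI)
        fix i i' assume "i \<in> ?U" "i' \<in> ?U" and eq: "\<sigma> (\<kappa> i) i = \<sigma> (\<kappa> i') i'"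
        then obtain k k' where k: "i \<in> I k" "i' \<in> I k'" by blast
        then have eq': "\<sigma> k i = \<sigma> k' i'" using eq \<kappa> by simp
        have "\<sigma> k i \<in> \<sigma> k ` I k" using k(1) by (rule imageI)
        moreover have "\<sigma> k i \<in> \<sigma> k' ` I k'" unfolding eq' using k(2) by (rule imageI)
        ultimately have "k = k'" by (rule \<sigma>disj)
        then show "i = i'" using inj_onD[OF I(3)[of k]] k eq' by blast
      qed
    qed
    finally have "(\<Sum>k<N. \<bar>\<phi> k z\<bar> powr p) \<le> 2 / c * nm z powr p" using c by (simp add: mult_left_mono divide_right_mono)
    then show ?thesis using K nm_nonneg by (simp add: powr_mult)
  qed
  define B where "B z = (if z \<in> d then \<lambda>k. \<phi> k z else (\<lambda>k. 0))" for z
  have Bb: "lpn (B z) \<le> K * nm z" if z: "z \<in> d" for z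
    using sum_le[OF z] z K(1) nm_nonneg[of z] by (intro lp_norm_leI) (auto simp: B_def)
  have BL: "B \<in> Lop_lp w p"
  proof (rule LlpI[of _ K])
    show "B z \<in> lp" if "z \<in> d" for z
      using sum_le[OF that] that by (intro lp_memI) (auto simp: B_def)
    show "B (\<lambda>n. x n + y n) = (\<lambda>n. B x n + B y n)" if "x \<in> d" "y \<in> d" for x y
      using that by (simp add: B_def d_add \<phi>_def add_divide_distrib sum.distrib distrib_left)
    show "B (\<lambda>n. a * x n) = (\<lambda>n. a * B x n)" if "x \<in> d" for x a
      using that by (simp add: B_def d_scale \<phi>_def sum_distrib_left mult.left_commute)
  qed (auto simp: Bb, simp add: B_def)
  have "lpn (\<lambda>i. B (y (r j)) i - unitv j i) \<le> \<epsilon> j" for j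
  proof -
    let ?s = "off (M j) (M (Suc j)) (y (r j))"
    have s: "?s \<in> d" by (rule off_d[OF y(1)])
    \<comment> \<open>The j-th functional is 1 at its own vector and does not see the part off the
      window; the others see only that part.\<close>
    have "(\<lambda>i. B (y (r j)) i - unitv j i) = B ?s"
    proof
      fix k
      show "B (y (r j)) k - unitv j k = B ?s k"
      proof (cases "k = j")
        case True
        have "(\<Sum>i\<in>I k. g k i * (y (r k) i / y (r k) i)) = S k"
          unfolding S_def using p by (intro sum.cong) (auto simp: g_def)
        then have 1: "\<phi> k (y (r k)) = 1" using S(2)[of k] by (simp add: \<phi>_def)
        have "?s i = 0" if "i \<in> I k" for i using that I(2)[of k] True by (auto simp: off_def)
        then have "\<phi> k ?s = 0" by (simp add: \<phi>_def)
        then show ?thesis using 1 True s y(1) by (simp add: B_def unitv_def)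
      next
        case False
        have "?s i = y (r j) i" if "i \<in> I k" for i
          using that I(2)[of k] False windows_disjoint[OF rM(2), of k i j] by (auto simp: off_def)
        then have "\<phi> k ?s = \<phi> k (y (r j))" by (simp add: \<phi>_def)
        then show ?thesis using False s y(1) by (simp add: B_def unitv_def)
      qed
    qed
    then have "lpn (\<lambda>i. B (y (r j)) i - unitv j i) \<le> K * nm ?s" using Bb[OF s] by simp
    also have "\<dots> \<le> K * (\<epsilon> j / K)" using rM(3)[of j] K by (intro mult_left_mono) (auto simp: Q_def)
    also have "\<dots> = \<epsilon> j" using K by simp
    finally show ?thesis .
  qed
  then show ?thesis using that[OF rM(1) BL] by blast
qed

section \<open>Disjoint vectors and series in lp\<close>

lemma unitv_sum: "(\<Sum>k<n. a k * unitv k i) = (if i < n then a i else 0)"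
proof -
  have "(\<Sum>k<n. a k * unitv k i) = (\<Sum>k<n. if k = i then a k else 0)"
    by (intro sum.cong) (auto simp: unitv_def)
  then show ?thesis by (simp add: sum.delta)
qed

lemma lp_diff:
  assumes "x \<in> lp" "y \<in> lp"
  shows "(\<lambda>i. x i - y i) \<in> lp"
proof -
  have "summable (\<lambda>i. 2 powr p * (\<bar>x i\<bar> powr p + \<bar>y i\<bar> powr p))"
    using assms by (intro summable_mult summable_add) (auto simp: lp_space_def)
  moreover have "norm (\<bar>x i - y i\<bar> powr p) \<le> 2 powr p * (\<bar>x i\<bar> powr p + \<bar>y i\<bar> powr p)" for i
  proof -
    have "\<bar>x i - y i\<bar> powr p \<le> (2 * max \<bar>x i\<bar> \<bar>y i\<bar>) powr p" using p by (intro powr_mono2) auto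
    also have "\<dots> \<le> 2 powr p * (\<bar>x i\<bar> powr p + \<bar>y i\<bar> powr p)" by (simp add: powr_mult max_def)
    finally show ?thesis by simp
  qed
  ultimately have "summable (\<lambda>i. \<bar>x i - y i\<bar> powr p)" by (rule summable_comparison_test'[where N = 0])
  then show ?thesis by (simp add: lp_space_def)
qed

text \<open>Each coordinate belongs to at most one vector, so the infinite combination with
  coefficients \<open>a\<close> is the closed formula \<open>a (\<kappa> i) * v i\<close>, without a
  series. Grouping a finite weighted sum by owner bounds each group by the norm of one vector, which
  gives the upper p-estimate.\<close>

lemma disjoint_upper_estimate:
  assumes u: "\<And>n. u n \<in> d" "\<And>n. nm (u n) \<le> B" and disj: "\<And>i j k. u j i \<noteq> 0 \<Longrightarrow> u k i \<noteq> 0 \<Longrightarrow> j = k"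
  obtains \<kappa> :: "nat \<Rightarrow> nat" and v :: rseq where "\<And>k i. u k i = (if \<kappa> i = k then v i else 0)"
    "\<And>a. a \<in> lp \<Longrightarrow> (\<lambda>i. a (\<kappa> i) * v i) \<in> d" "\<And>a. a \<in> lp \<Longrightarrow> nm (\<lambda>i. a (\<kappa> i) * v i) \<le> B * lpn a"
proof -
  \<comment> \<open>Where all vectors vanish, \<open>\<kappa> i\<close> is arbitrary and
    \<open>v i\<close> is 0.\<close>
  define \<kappa> where "\<kappa> i = (SOME k. u k i \<noteq> 0)" for i
  define v where "v i = u (\<kappa> i) i" for i
  have uk: "u k i = (if \<kappa> i = k then v i else 0)" for k i
  proof (cases "u k i = 0")
    case False
    then have "u (\<kappa> i) i \<noteq> 0" unfolding \<kappa>_def by (rule someI)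
    then have "\<kappa> i = k" using False disj by blast
    then show ?thesis by (simp add: v_def)
  qed (auto simp: v_def)
  have B: "0 \<le> B" using order_trans[OF nm_nonneg u(2)] .
  have bd: "wbound (\<lambda>i. a (\<kappa> i) * v i) ((B * lpn a) powr p)" if a: "a \<in> lp" for a
  proof (rule wboundI)
    fix I :: "nat set" and \<sigma> :: "nat \<Rightarrow> nat" assume I: "finite I" "inj_on \<sigma> I"
    have "(\<Sum>i\<in>I. w (\<sigma> i) * \<bar>a (\<kappa> i) * v i\<bar> powr p)
        = (\<Sum>k\<in>\<kappa> ` I. \<Sum>i\<in>{i \<in> I. \<kappa> i = k}. w (\<sigma> i) * \<bar>a (\<kappa> i) * v i\<bar> powr p)"
      by (rule sum.image_gen[OF I(1)])
    also have "\<dots> \<le> (\<Sum>k\<in>\<kappa> ` I. \<bar>a k\<bar> powr p * B powr p)"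
    proof (rule sum_mono)
      fix k
      have "(\<Sum>i\<in>{i \<in> I. \<kappa> i = k}. w (\<sigma> i) * \<bar>a (\<kappa> i) * v i\<bar> powr p)
          = \<bar>a k\<bar> powr p * (\<Sum>i\<in>{i \<in> I. \<kappa> i = k}. w (\<sigma> i) * \<bar>u k i\<bar> powr p)"
        unfolding sum_distrib_left by (intro sum.cong) (auto simp: uk abs_mult powr_mult)
      also have "\<dots> \<le> \<bar>a k\<bar> powr p * B powr p"
        using I by (intro mult_left_mono wboundD[OF wbound_le[OF u]]) (auto simp: inj_on_def)
      finally show "(\<Sum>i\<in>{i \<in> I. \<kappa> i = k}. w (\<sigma> i) * \<bar>a (\<kappa> i) * v i\<bar> powr p) \<le> \<bar>a k\<bar> powr p * B powr p" .
    qed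
    also have "\<dots> = (\<Sum>k\<in>\<kappa> ` I. \<bar>a k\<bar> powr p) * B powr p" by (simp add: sum_distrib_right)
    also have "\<dots> \<le> lpn a powr p * B powr p"
      using I by (intro mult_right_mono lp_sum_le[OF p_pos a]) auto
    also have "\<dots> = (B * lpn a) powr p" using B lp_norm_nonneg by (simp add: powr_mult)
    finally show "(\<Sum>i\<in>I. w (\<sigma> i) * \<bar>a (\<kappa> i) * v i\<bar> powr p) \<le> (B * lpn a) powr p" .
  qed
  show ?thesis
  proof (rule that[of \<kappa> v, OF uk])
    show "(\<lambda>i. a (\<kappa> i) * v i) \<in> d" if "a \<in> lp" for a using lorentz_memI[OF bd[OF that]] .
    show "nm (\<lambda>i. a (\<kappa> i) * v i) \<le> B * lpn a" if "a \<in> lp" for a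
      using nm_leI[OF bd[OF that]] B lp_norm_nonneg by simp
  qed
qed

lemma lp_tail_tendsto_0:
  assumes "a \<in> lp"
  shows "(\<lambda>i. if i < n then 0 else a i) \<in> lp"
    and "(\<lambda>n. lpn (\<lambda>i. if i < n then 0 else a i)) \<longlonglongrightarrow> 0"
proof -
  let ?t = "\<lambda>n i. if i < n then 0 else a i"
  have sm: "summable (\<lambda>i. \<bar>a i\<bar> powr p)" using assms by (simp add: lp_space_def)
  define R where "R n = lpn a powr p - (\<Sum>i<n. \<bar>a i\<bar> powr p)" for n
  have part: "(\<Sum>i<N. \<bar>?t n i\<bar> powr p) \<le> R n" for N n
  proof -
    have "(\<Sum>i<N. \<bar>?t n i\<bar> powr p) = (\<Sum>i\<in>{n..<N}. \<bar>a i\<bar> powr p)"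
      by (rule sum.mono_neutral_cong_right) auto
    also have "(\<Sum>i\<in>{n..<N}. \<bar>a i\<bar> powr p) + (\<Sum>i<n. \<bar>a i\<bar> powr p) = (\<Sum>i\<in>{n..<N} \<union> {..<n}. \<bar>a i\<bar> powr p)"
      by (rule sum.union_disjoint[symmetric]) auto
    then have "(\<Sum>i\<in>{n..<N}. \<bar>a i\<bar> powr p) = (\<Sum>i\<in>{n..<N} \<union> {..<n}. \<bar>a i\<bar> powr p) - (\<Sum>i<n. \<bar>a i\<bar> powr p)"
      by simp
    also have "\<dots> \<le> R n" unfolding R_def using lp_sum_le[OF p_pos assms] by simp
    finally show ?thesis .
  qed
  then show "?t n \<in> lp" by (rule lp_memI)
  have R0: "R \<longlonglongrightarrow> 0"
    using tendsto_diff[OF tendsto_const[of "lpn a powr p"] summable_LIMSEQ[OF sm]]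
    unfolding R_def lp_norm_powr[OF p_pos assms] by simp
  have le: "lpn (?t n) \<le> R n powr (1 / p)" for n
  proof (rule lp_norm_leI)
    fix N
    have "0 \<le> R n" using part[where N = 0 and n = n] by simp
    then show "(\<Sum>i<N. \<bar>?t n i\<bar> powr p) \<le> (R n powr (1 / p)) powr p"
      using part[of n N] p by (simp add: powr_powr)
  qed simp
  have "(\<lambda>n. R n powr (1 / p)) \<longlonglongrightarrow> 0 powr (1 / p)"
    using R0 p part[where N = 0] by (intro tendsto_powr2) auto
  then have "(\<lambda>n. R n powr (1 / p)) \<longlonglongrightarrow> 0" by simp
  then show "(\<lambda>n. lpn (?t n)) \<longlonglongrightarrow> 0"
    by (rule Lim_null_comparison[rotated]) (use le lp_norm_nonneg in simp)
qed

subsection \<open>Noncompact operators and the formal identity\<close>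

text \<open>For finite combinations the errors at the unit vectors add up to at most the sum of
  \<open>\<bar>a k\<bar> * \<epsilon> k\<close>, hence to at most \<open>e\<close> times the
  lp-norm. Lower semicontinuity extends this to all of lp.\<close>

lemma formal_id_near_factor:
  assumes T: "T \<in> L" "T \<notin> compact_ops w p" and e: "e > 0"
  obtains C D B where "C \<in> L" "\<And>a. a \<in> lp \<Longrightarrow> D a \<in> d" "\<And>a. a \<in> lp \<Longrightarrow> nm (D a) \<le> B * lpn a"
    "\<And>a b. D (\<lambda>n. a n + b n) = (\<lambda>n. D a n + D b n)" "\<And>a c. D (\<lambda>n. c * a n) = (\<lambda>n. c * D a n)"
    "\<And>a. a \<in> lp \<Longrightarrow> nm (\<lambda>i. C (T (D a)) i - a i) \<le> e * lpn a"
proof -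
  obtain u B \<delta> where u: "\<And>n. u n \<in> d" "\<And>n. nm (u n) \<le> B" "\<And>i j k. u j i \<noteq> 0 \<Longrightarrow> u k i \<noteq> 0 \<Longrightarrow> j = k"
    "\<And>i. (\<lambda>n. T (u n) i) \<longlonglongrightarrow> 0" "\<delta> > 0" "\<And>n. \<delta> \<le> nm (T (u n))"
    by (rule noncompact_blocks[OF T]) blast
  have yd: "T (u n) \<in> d" for n using Lop_mem[OF T(1) u(1)] .
  \<comment> \<open>A geometric series with sum \<open>e\<close>.\<close>
  define \<epsilon> where "\<epsilon> j = e * (1 / 2) ^ Suc j" for j :: nat
  have \<epsilon>: "\<epsilon> j > 0" for j using e by (simp add: \<epsilon>_def)
  have "\<epsilon> sums (e * 1)" unfolding \<epsilon>_def by (intro sums_mult power_half_series)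
  then have \<epsilon>sum: "(\<Sum>j<n. \<epsilon> j) \<le> e" for n
    using sum_le_suminf[of \<epsilon> "{..<n}"] less_imp_le[OF \<epsilon>] by (auto simp: sums_iff)
  have "\<exists>r C. strict_mono (r :: nat \<Rightarrow> nat) \<and> C \<in> L \<and> (\<forall>j. nm (\<lambda>i. C (T (u (r j))) i - unitv j i) \<le> \<epsilon> j)"
  proof (cases "\<exists>\<theta>>0. \<forall>N. \<exists>n\<ge>N. \<exists>m. \<theta> \<le> \<bar>T (u n) m\<bar>")
    case True
    then obtain \<theta> where \<theta>: "\<theta> > 0" "\<And>N. \<exists>n\<ge>N. \<exists>m. \<theta> \<le> \<bar>T (u n) m\<bar>" by blast
    show ?thesis
      by (rule select_large_coordinates[where \<epsilon> = \<epsilon>, OF yd u(4) \<theta> \<epsilon>]) blast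
  next
    case False
    then have flat: "\<exists>N. \<forall>n\<ge>N. \<forall>i. \<bar>T (u n) i\<bar> < \<theta>" if "\<theta> > 0" for \<theta> using that by (meson not_le)
    obtain r C where r: "strict_mono (r :: nat \<Rightarrow> nat)" and C: "C \<in> Lop_lp w p"
      "\<And>j. lpn (\<lambda>i. C (T (u (r j))) i - unitv j i) \<le> \<epsilon> j"
      by (rule map_flat_sequence[where \<epsilon> = \<epsilon>, OF yd u(4-6) flat \<epsilon>]) blast+
    \<comment> \<open>In the flat case the errors are measured in lp, whose norm dominates the
      Lorentz norm; so both cases give the same kind of operator.\<close>
    have "nm (\<lambda>i. C (T (u (r j))) i - unitv j i) \<le> lpn (\<lambda>i. C (T (u (r j))) i - unitv j i)" for j
      by (intro nm_le_lp lp_diff Llp_mem[OF C(1)] unitv_lp)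
    then show ?thesis using r Llp_Lop[OF C(1)] order_trans[OF _ C(2)] by blast
  qed
  then obtain r C where r: "strict_mono (r :: nat \<Rightarrow> nat)" and C: "C \<in> L"
    "\<And>j. nm (\<lambda>i. C (T (u (r j))) i - unitv j i) \<le> \<epsilon> j" by blast
  have disj: "j = k" if "u (r j) i \<noteq> 0" "u (r k) i \<noteq> 0" for i j k
    using u(3)[OF that] r by (simp add: strict_mono_eq)
  obtain \<kappa> v where \<kappa>: "\<And>k i. u (r k) i = (if \<kappa> i = k then v i else 0)"
    and Dd: "\<And>a. a \<in> lp \<Longrightarrow> (\<lambda>i. a (\<kappa> i) * v i) \<in> d"
    and Dn: "\<And>a. a \<in> lp \<Longrightarrow> nm (\<lambda>i. a (\<kappa> i) * v i) \<le> B * lpn a"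
    by (rule disjoint_upper_estimate[of "\<lambda>k. u (r k)" B]) (use u(1,2) disj in blast)+
  \<comment> \<open>Being a pointwise formula, \<open>D\<close> is linear on all sequences; only its
    bound refers to lp.\<close>
  define D where "D a = (\<lambda>i. a (\<kappa> i) * v i)" for a :: rseq
  define U where "U = C \<circ> T"
  have U: "U \<in> L" unfolding U_def by (rule Lop_comp[OF T(1) C(1)])
  obtain K where K: "K > 0" "\<And>x. x \<in> d \<Longrightarrow> nm (U x) \<le> K * nm x" by (rule Lop_bound[OF U]) blast
  have "nm (\<lambda>i. U (D a) i - a i) \<le> e * lpn a" if a: "a \<in> lp" for a
  proof -
    \<comment> \<open>The partial sums of \<open>D a\<close>. The remainder is \<open>D\<close> of a
      tail of \<open>a\<close>, so the images under \<open>U\<close> converge, in particular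
      coordinatewise.\<close>
    define h where "h n i = (\<Sum>k<n. a k * u (r k) i)" for n i
    define t where "t n i = (if i < n then 0 else a i)" for n i
    have hd: "h n \<in> d" for n unfolding h_def by (rule d_sum) (rule u)
    have tl: "t n \<in> lp" for n
      unfolding t_def by (rule lp_tail_tendsto_0(1)[OF a])
    have t0: "(\<lambda>n. lpn (t n)) \<longlonglongrightarrow> 0"
      unfolding t_def by (rule lp_tail_tendsto_0(2)[OF a])
    have hD: "(\<lambda>i. D a i - h n i) = D (t n)" for n
    proof
      fix i
      have "h n i = (\<Sum>k<n. if k = \<kappa> i then a k * v i else 0)"
        unfolding h_def by (intro sum.cong) (auto simp: \<kappa>)
      then show "D a i - h n i = D (t n) i" by (simp add: sum.delta D_def t_def)
    qed
    define x where "x n = (\<lambda>i. U (h n) i - (\<Sum>k<n. a k * unitv k i))" for n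
    have Uh: "U (h n) = (\<lambda>i. \<Sum>k<n. a k * U (u (r k)) i)" for n
      unfolding h_def by (rule Lop_sum[OF U]) (rule u)
    have x_eq: "x n = (\<lambda>i. \<Sum>k<n. a k * (U (u (r k)) i - unitv k i))" for n
      by (simp add: x_def Uh sum_subtractf right_diff_distrib)
    have rd: "(\<lambda>i. U (u (r k)) i - unitv k i) \<in> d" for k
      by (rule d_diff[OF Lop_mem[OF U u(1)] unitv_d])
    have xd: "x n \<in> d" for n unfolding x_eq by (rule d_sum) (rule rd)
    have xn: "nm (x n) \<le> e * lpn a" for n
    proof -
      have "nm (x n) \<le> (\<Sum>k<n. \<bar>a k\<bar> * nm (\<lambda>i. U (u (r k)) i - unitv k i))"
        unfolding x_eq by (rule nm_sum_le) (rule rd)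
      also have "\<dots> \<le> (\<Sum>k<n. lpn a * \<epsilon> k)"
        using order_trans[OF coord_le_nm[OF lp_subset_d[OF a]] nm_le_lp[OF a]] C(2) lp_norm_nonneg nm_nonneg
        by (intro sum_mono mult_mono) (auto simp: U_def)
      also have "\<dots> \<le> lpn a * e"
        unfolding sum_distrib_left[symmetric] using \<epsilon>sum lp_norm_nonneg by (intro mult_left_mono)
      finally show ?thesis by (simp add: mult.commute)
    qed
    have "(\<lambda>n. x n i) \<longlonglongrightarrow> U (D a) i - a i" for i
    proof -
      have "(\<lambda>n. U (D a) i - U (h n) i) \<longlonglongrightarrow> 0"
      proof (rule Lim_null_comparison)
        have "\<bar>U (D a) i - U (h n) i\<bar> \<le> K * (B * lpn (t n))" for n
        proof -
          have td: "D (t n) \<in> d" using Dd[OF tl] by (simp add: D_def)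
          have "(\<lambda>i. U (D a) i - U (h n) i) = U (D (t n))"
            using Lop_diff[OF U _ hd, of "D a" n] Dd[OF a] hD by (simp add: D_def)
          then have "\<bar>U (D a) i - U (h n) i\<bar> = \<bar>U (D (t n)) i\<bar>" by metis
          also have "\<dots> \<le> nm (U (D (t n)))" by (rule coord_le_nm[OF Lop_mem[OF U td]])
          also have "\<dots> \<le> K * nm (D (t n))" by (rule K(2)[OF td])
          also have "\<dots> \<le> K * (B * lpn (t n))" using Dn[OF tl] K(1) by (intro mult_left_mono) (auto simp: D_def)
          finally show ?thesis .
        qed
        then show "\<forall>\<^sub>F n in sequentially. norm (U (D a) i - U (h n) i) \<le> K * (B * lpn (t n))" by simp
        show "(\<lambda>n. K * (B * lpn (t n))) \<longlonglongrightarrow> 0" using t0 by (intro tendsto_mult_right_zero)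
      qed
      from tendsto_diff[OF tendsto_const[of "U (D a) i"] this]
      have 1: "(\<lambda>n. U (h n) i) \<longlonglongrightarrow> U (D a) i" by simp
      have "eventually (\<lambda>n. (\<Sum>k<n. a k * unitv k i) = a i) sequentially"
        unfolding unitv_sum eventually_sequentially by (auto intro!: exI[of _ "Suc i"])
      then have 2: "(\<lambda>n. \<Sum>k<n. a k * unitv k i) \<longlonglongrightarrow> a i" by (rule tendsto_eventually)
      show ?thesis unfolding x_def by (rule tendsto_diff[OF 1 2])
    qed
    from fatou(2)[OF xd xn this] show ?thesis .
  qed
  then show ?thesis
    using that[OF C(1), of D B] Dd Dn by (simp add: D_def U_def algebra_simps)
qed

text \<open>A member of \<open>Jj w p\<close> has the form \<open>A \<circ> B\<close> with the
  formal identity hidden in between. Replacing it by an approximation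
  \<open>C \<circ> T \<circ> D\<close> gives a nearby operator with \<open>T\<close> as a factor,
  hence one in \<open>J\<close>.\<close>

lemma Jj_subset_ideal:
  assumes J: "closed_ideal w p J" and T: "T \<in> J" "T \<notin> compact_ops w p"
  shows "Jj_closure w p \<subseteq> J"
proof -
  have JL: "J \<subseteq> L" and comp: "\<And>A S B. A \<in> L \<Longrightarrow> S \<in> J \<Longrightarrow> B \<in> L \<Longrightarrow> A \<circ> S \<circ> B \<in> J"
    and closed: "\<And>T. T \<in> L \<Longrightarrow> (\<forall>e>0. \<exists>S\<in>J. dopnorm w p (op_diff T S) < e) \<Longrightarrow> T \<in> J"
    using J unfolding closed_ideal_def by blast+
  have TL: "T \<in> L" using T(1) JL by blast
  have "S \<in> J" if S: "S \<in> Jj w p" for S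
  proof -
    obtain A B where A: "A \<in> L" and B: "B \<in> Lop_lp w p" and AB: "S = A \<circ> B" using S Jj_iff by blast
    have SL: "S \<in> L" using S Jj_subset by blast
    obtain a where a: "a > 0" "\<And>x. x \<in> d \<Longrightarrow> nm (A x) \<le> a * nm x" by (rule Lop_bound[OF A]) blast
    obtain b where b: "b > 0" "\<And>x. x \<in> d \<Longrightarrow> lpn (B x) \<le> b * nm x" by (rule Llp_bound[OF B]) blast
    have "\<exists>R\<in>J. near e S R" if e: "e > 0" for e
    proof -
      have "e / (a * b) > 0" using e a b by simp
      then obtain C D K where C: "C \<in> L" and D: "\<And>a. a \<in> lp \<Longrightarrow> D a \<in> d" "\<And>a. a \<in> lp \<Longrightarrow> nm (D a) \<le> K * lpn a"
        "\<And>a b. D (\<lambda>n. a n + b n) = (\<lambda>n. D a n + D b n)" "\<And>a c. D (\<lambda>n. c * a n) = (\<lambda>n. c * D a n)"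
        and near: "\<And>x. x \<in> lp \<Longrightarrow> nm (\<lambda>i. C (T (D x)) i - x i) \<le> e / (a * b) * lpn x"
        by (rule formal_id_near_factor[OF TL T(2)]) blast
      have BL: "B \<in> L" by (rule Llp_Lop[OF B])
      \<comment> \<open>\<open>D\<close> is bounded only for the lp-norm; preceded by
        \<open>B\<close> it becomes an operator on the Lorentz space, as the ideal property
        requires.\<close>
      have DB: "D \<circ> B \<in> L"
      proof (rule LopI[of _ "\<bar>K\<bar> * b"])
        show "(D \<circ> B) x \<in> d" for x using D(1) Llp_mem[OF B] by simp
        show "nm ((D \<circ> B) x) \<le> \<bar>K\<bar> * b * nm x" if "x \<in> d" for x
        proof -
          have "nm (D (B x)) \<le> K * lpn (B x)" by (rule D(2)[OF Llp_mem[OF B]])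
          also have "\<dots> \<le> \<bar>K\<bar> * lpn (B x)" using lp_norm_nonneg by (intro mult_right_mono) auto
          also have "\<dots> \<le> \<bar>K\<bar> * (b * nm x)" using b(2)[OF that] by (intro mult_left_mono) auto
          finally show ?thesis by (simp add: mult.assoc)
        qed
        show "(D \<circ> B) x = (\<lambda>n. 0)" if "x \<notin> d" for x
          using Lop_outside[OF BL that] D(4)[of 0 "\<lambda>n. 0"] by simp
      qed (simp_all add: Lop_add[OF BL] Lop_scale[OF BL] D(3,4))
      have R: "(A \<circ> C) \<circ> T \<circ> (D \<circ> B) \<in> J" by (intro comp T(1) DB Lop_comp[OF C A])
      have "near e S ((A \<circ> C) \<circ> T \<circ> (D \<circ> B))"
        unfolding near_def
      proof
        fix x assume x: "x \<in> d"
        have Bx: "B x \<in> lp" by (rule Llp_mem[OF B])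
        have 1: "B x \<in> d" "C (T (D (B x))) \<in> d"
          using lp_subset_d[OF Bx] Lop_mem[OF C Lop_mem[OF TL D(1)[OF Bx]]] by auto
        have "nm (\<lambda>n. S x n - ((A \<circ> C) \<circ> T \<circ> (D \<circ> B)) x n) = nm (A (\<lambda>n. B x n - C (T (D (B x))) n))"
          using Lop_diff[OF A 1] by (simp add: AB)
        also have "\<dots> \<le> a * nm (\<lambda>n. B x n - C (T (D (B x))) n)" by (rule a(2)[OF d_diff[OF 1]])
        also have "\<dots> = a * nm (\<lambda>n. C (T (D (B x))) n - B x n)" by (simp only: nm_diff_commute[OF 1])
        also have "\<dots> \<le> a * (e / (a * b) * lpn (B x))" using near[OF Bx] a(1) by (intro mult_left_mono) auto
        also have "\<dots> \<le> a * (e / (a * b) * (b * nm x))"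
          using b(2)[OF x] a(1) b(1) e by (intro mult_left_mono) auto
        also have "\<dots> = e * nm x" using a(1) b(1) by simp
        finally show "nm (\<lambda>n. S x n - ((A \<circ> C) \<circ> T \<circ> (D \<circ> B)) x n) \<le> e * nm x" .
      qed
      then show ?thesis using R by blast
    qed
    then show "S \<in> J" using closed[OF SL] approx_iff[OF SL JL] by blast
  qed
  then have "Jj w p \<subseteq> J" by blast
  then show ?thesis using closed unfolding Jj_closure_def by blast
qed

text \<open>Normalised indicators of initial segments. The p-th power of the norm of the indicator
  is the sum \<open>S n\<close> of the first n + 1 weights, which diverges, so the heights tend to
  0.\<close>

lemma flat_vectors:
  obtains y :: "nat \<Rightarrow> rseq" where "\<And>n. y n \<in> d" "\<And>n. nm (y n) \<le> 1" "\<And>n. 1 \<le> nm (y n)"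
    "\<And>\<theta>. \<theta> > 0 \<Longrightarrow> \<exists>N. \<forall>n\<ge>N. \<forall>i. \<bar>y n i\<bar> < \<theta>"
proof -
  define S where "S n = (\<Sum>i<Suc n. w i)" for n
  have S1: "1 \<le> S n" for n
    unfolding S_def using member_le_sum[of 0 "{..<Suc n}" w] w_nonneg w1 by simp
  define y where "y n i = (if i < Suc n then S n powr (- (1 / p)) else 0)" for n i
  have yp: "\<bar>y n i\<bar> powr p = (if i < Suc n then inverse (S n) else 0)" for n i
  proof -
    have "(S n powr (- (1 / p))) powr p = S n powr (- 1)" using p by (simp add: powr_powr)
    also have "\<dots> = inverse (S n)" using S1[of n] by (simp add: powr_minus)
    finally show ?thesis by (simp add: y_def)
  qed
  have bound: "wbound (y n) (1 powr p)" for n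
  proof (rule wboundI)
    fix I :: "nat set" and \<sigma> :: "nat \<Rightarrow> nat" assume I: "finite I" "inj_on \<sigma> I"
    let ?I = "I \<inter> {..<Suc n}"
    have "(\<Sum>i\<in>I. w (\<sigma> i) * \<bar>y n i\<bar> powr p) = (\<Sum>i\<in>?I. w (\<sigma> i) * \<bar>1::real\<bar> powr p) * inverse (S n)"
      unfolding sum_distrib_right by (rule sum.mono_neutral_cong_right) (use I in \<open>auto simp: yp\<close>)
    \<comment> \<open>The comparison with the rearrangement asks only for boundedness, so it applies
      to the constant sequence 1, although that is not null.\<close>
    also have "(\<Sum>i\<in>?I. w (\<sigma> i) * \<bar>1::real\<bar> powr p) \<le> (\<Sum>m<card ?I. w m * rearr (\<lambda>_. 1) m powr p)"
      using I weighted_sum_le_rearr[of "\<lambda>_. 1" 1 ?I \<sigma>] by (simp add: inj_on_Int)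
    also have "\<dots> \<le> (\<Sum>m<card ?I. w m * 1 powr p)"
      using rearr_nonneg[of "\<lambda>_. 1" 1] rearr_le[of "{..<m}" m "\<lambda>_. 1" 1 for m] w_nonneg p
      by (intro sum_mono mult_left_mono powr_mono2) auto
    also have "\<dots> \<le> S n"
      unfolding S_def using card_mono[of "{..<Suc n}" ?I] w_nonneg
      by (simp only: powr_one_eq_one mult_1_right) (rule sum_mono2, auto)
    finally show "(\<Sum>i\<in>I. w (\<sigma> i) * \<bar>y n i\<bar> powr p) \<le> 1 powr p"
      using S1[of n] by (simp add: mult_right_mono field_simps)
  qed
  show ?thesis
  proof (rule that[of y])
    show yd: "y n \<in> d" for n by (rule lorentz_memI[OF bound])
    show "nm (y n) \<le> 1" for n by (rule nm_leI[OF bound]) simp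
    show "1 \<le> nm (y n)" for n
    proof -
      have "(\<Sum>i<Suc n. w (id i) * \<bar>y n i\<bar> powr p) \<le> nm (y n) powr p"
        by (rule wboundD[OF wbound_nm[OF yd]]) auto
      moreover have "(\<Sum>i<Suc n. w (id i) * \<bar>y n i\<bar> powr p) = S n * inverse (S n)"
        unfolding S_def[of n] sum_distrib_right by (intro sum.cong) (auto simp: yp S_def)
      ultimately have "1 powr p \<le> nm (y n) powr p" using S1[of n] by simp
      then show ?thesis using powr_p_le_iff[of 1 "nm (y n)"] nm_nonneg by simp
    qed
    fix \<theta> :: real assume \<theta>: "\<theta> > 0"
    obtain N where N: "inverse (\<theta> powr p) < (\<Sum>i<N. w i)" using w_sum_unbounded by blast
    show "\<exists>N. \<forall>n\<ge>N. \<forall>i. \<bar>y n i\<bar> < \<theta>"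
    proof (intro exI[of _ N] allI impI)
      fix n i assume n: "N \<le> n"
      have "(\<Sum>i<N. w i) \<le> S n" unfolding S_def using n w_nonneg by (intro sum_mono2) auto
      then have "inverse (S n) < \<theta> powr p"
        using less_imp_inverse_less[of "inverse (\<theta> powr p)" "S n"] N \<theta> by simp
      then have "\<bar>y n i\<bar> powr p < \<theta> powr p" using \<theta> by (simp add: yp)
      then show "\<bar>y n i\<bar> < \<theta>" using powr_p_le_iff[of \<theta> "\<bar>y n i\<bar>"] \<theta> by simp
    qed
  qed
qed

text \<open>The operator built for flat vectors sends a bounded sequence close to the unit vectors,
  which are uniformly separated, and it factors through lp by construction.\<close>

lemma Jj_noncompact: "\<exists>T\<in>Jj w p. T \<notin> compact_ops w p"
proof -
  obtain y :: "nat \<Rightarrow> rseq" where y: "\<And>n. y n \<in> d" "\<And>n. nm (y n) \<le> 1" "\<And>n. 1 \<le> nm (y n)"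
    and flat: "\<And>\<theta>. \<theta> > 0 \<Longrightarrow> \<exists>N. \<forall>n\<ge>N. \<forall>i. \<bar>y n i\<bar> < \<theta>" by (rule flat_vectors) blast
  have null: "(\<lambda>n. y n i) \<longlonglongrightarrow> 0" for i
    unfolding LIMSEQ_iff using flat by (metis diff_zero real_norm_def)
  \<comment> \<open>With 1/8 for this error and 1/8 for the distance to a supposed limit, two unit
    vectors would differ by at most 1/2 in every coordinate.\<close>
  obtain r B where r: "strict_mono (r :: nat \<Rightarrow> nat)" and B: "B \<in> Lop_lp w p"
    "\<And>j. lpn (\<lambda>i. B (y (r j)) i - unitv j i) \<le> 1 / 8"
    by (rule map_flat_sequence[OF y(1) null zero_less_one y(3) flat, of "\<lambda>_. 1 / 8"]) auto
  have BL: "B \<in> L" by (rule Llp_Lop[OF B(1)])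
  have near: "nm (\<lambda>i. B (y (r j)) i - unitv j i) \<le> 1 / 8" for j
    by (rule order_trans[OF nm_le_lp B(2)]) (intro lp_diff Llp_mem[OF B(1)] unitv_lp)
  define I where "I = (\<lambda>x. if x \<in> d then x else (\<lambda>n. 0))"
  have "I \<in> L" by (rule LopI[of _ 1]) (auto simp: I_def d_add d_scale)
  moreover have "I \<circ> B = B" using lp_subset_d[OF Llp_mem[OF B(1)]] by (simp add: I_def fun_eq_iff)
  ultimately have "B \<in> Jj w p" unfolding Jj_iff using B(1) by metis
  moreover have "B \<notin> compact_ops w p"
  proof
    assume "B \<in> compact_ops w p"
    then have "(\<forall>k. y (r k) \<in> d) \<and> (\<exists>M. \<forall>k. nm (y (r k)) \<le> M) \<longrightarrow>
       (\<exists>s::nat\<Rightarrow>nat. strict_mono s \<and> (\<exists>z\<in>d. (\<lambda>k. nm (\<lambda>n. B (y (r (s k))) n - z n)) \<longlonglongrightarrow> 0))"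
      unfolding compact_ops_def by (elim CollectE conjE) (erule allE[of _ "\<lambda>k. y (r k)"])
    then obtain s z where s: "strict_mono (s :: nat \<Rightarrow> nat)" and z: "z \<in> d"
      and lim: "(\<lambda>k. nm (\<lambda>n. B (y (r (s k))) n - z n)) \<longlonglongrightarrow> 0" using y by blast
    obtain N where N: "\<And>k. k \<ge> N \<Longrightarrow> nm (\<lambda>n. B (y (r (s k))) n - z n) < 1 / 8"
      using LIMSEQ_D[OF lim, of "1 / 8"] nm_nonneg by auto
    have close: "\<bar>unitv (s k) i - z i\<bar> \<le> 1 / 4" if "k \<ge> N" for k i
    proof -
      have "\<bar>B (y (r (s k))) i - unitv (s k) i\<bar> \<le> 1 / 8"
        by (rule order_trans[OF coord_le_nm near[of "s k"]]) (rule d_diff[OF Lop_mem[OF BL y(1)] unitv_d])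
      moreover have "\<bar>B (y (r (s k))) i - z i\<bar> \<le> 1 / 8"
        by (rule order_trans[OF coord_le_nm less_imp_le[OF N[OF that]]]) (rule d_diff[OF Lop_mem[OF BL y(1)] z])
      ultimately show ?thesis by linarith
    qed
    \<comment> \<open>At coordinate \<open>s N\<close> one of the two unit vectors is 1 and the
      other 0.\<close>
    have "s (Suc N) \<noteq> s N" using s by (simp add: strict_mono_eq)
    then show False using close[of N "s N"] close[of "Suc N" "s N"] by (simp add: unitv_def)
  qed
  ultimately show ?thesis by blast
qed

text \<open>Minimality of the closure among the closed ideals strictly containing the compact
  operators also excludes ideals strictly in between.\<close>

lemma immediate_successor:
  shows "compact_ops w p \<subset> Jj_closure w p"
    and "\<And>J. closed_ideal w p J \<Longrightarrow> compact_ops w p \<subset> J \<Longrightarrow> Jj_closure w p \<subseteq> J"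
proof -
  have "Jj w p \<subseteq> Jj_closure w p"
  proof
    fix T assume T: "T \<in> Jj w p"
    then have "T \<in> L" using Jj_subset by blast
    then show "T \<in> Jj_closure w p"
      unfolding Jj_closure_iff using T nm_zero nm_nonneg by (auto simp: near_def intro!: bexI[of _ T])
  qed
  then show "compact_ops w p \<subset> Jj_closure w p"
    using compact_subset_Jj_closure Jj_noncompact by blast
  show "Jj_closure w p \<subseteq> J" if J: "closed_ideal w p J" "compact_ops w p \<subset> J" for J
    using J(2) Jj_subset_ideal[OF J(1)] by blast
qed

end

theorem theorem4p7:
  fixes w :: "nat \<Rightarrow> real" and p :: real
  assumes p: "1 \<le> p"
    and w1: "w 0 = 1" and wdec: "decseq w" and w0: "w \<longlonglongrightarrow> 0"
    and wdiv: "\<not> summable w"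
    and two: "\<exists>s1 s2. symmetric_basic w p s1 \<and> symmetric_basic w p s2 \<and>
                \<not> seq_equiv w p s1 s2 \<and>
                (\<forall>s. symmetric_basic w p s \<longrightarrow> seq_equiv w p s s1 \<or> seq_equiv w p s s2)"
  shows "closed_ideal w p (Jj_closure w p) \<and>
         compact_ops w p \<subset> Jj_closure w p \<and>
         \<not> (\<exists>J. closed_ideal w p J \<and> compact_ops w p \<subset> J \<and> J \<subset> Jj_closure w p) \<and>
         (\<forall>J. closed_ideal w p J \<and> compact_ops w p \<subset> J \<longrightarrow> Jj_closure w p \<subseteq> J)"
proof -
  interpret lorentz_weight w p
    using p w1 wdec w0 wdiv by unfold_locales
  show ?thesis
    using closed_ideal_Jj_closure immediate_successor by blast
qed

end
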